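(* Let $d=2$. There exists a constant $C_*>0$ such that for every $n\in\mathbb{N}$ $$\inf_{\bar{\boldsymbol f}_n}\ \sup_{\boldsymbol f_*\in\mathcal{F}^{\mathrm L}_{\mathrm{INV}}}\ \mathsf{R}(\bar{\boldsymbol f}_n,\boldsymbol f_* )\ \ge\ C_*\,n^{-2/(2+d)},$$ where the infimum is over all measurable estimators $\bar{\boldsymbol f}_n$ depending on the sample $\mathcal{D}_n$.
   Context: Let $d=2$ and $I=[-1,1]$. $\mathcal{F}^{\mathrm L}_{\mathrm{INV}}$ is the set of bijections $\boldsymbol f:I^2\to I^2$ that are bi-Lipschitz, i.e. there is some $L\ge 1$ with $L^{-1}\|\boldsymbol x-\boldsymbol x'\|_2\le\|\boldsymbol f(\boldsymbol x)-\boldsymbol f(\boldsymbol x')\|_2\le L\|\boldsymbol x-\boldsymbol x'\|_2$ for all $\boldsymbol x,\boldsymbol x'\in I^2$. Model: $\mathcal{D}_n=\{(\boldsymbol X_i,\boldsymbol Y_i)\}_{i=1}^n\subset I^2\times\mathbb{R}^2$ are i.i.d. with $\boldsymbol Y_i=\boldsymbol f_*(\boldsymbol X_i)+\boldsymbol\varepsilon_i$, $\boldsymbol\varepsilon_i\sim N_2(\boldsymbol 0,\sigma^2\boldsymbol I_2)$ i.i.d., $\sigma^2>0$ fixed, $\boldsymbol f_*\in\mathcal{F}^{\mathrm L}_{\mathrm{INV}}$ the true function. The (fixed) marginal distribution $P_{\boldsymbol X}$ of $\boldsymbol X_i$ has a density that is positive and bounded on $I^2$. $\mathbb{E}_n$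 is expectation with respect to $\mathcal{D}_n$. An estimator $\bar{\boldsymbol f}_n$ is a measurable function of $\mathcal{D}_n$ with values in (measurable) maps $I^2\to\mathbb{R}^2$. For $\boldsymbol f=(f_1,f_2)$, $\|\boldsymbol f\|_{L^2(P_{\boldsymbol X})}=(\sum_{j=1}^2\int|f_j|^2\,dP_{\boldsymbol X})^{1/2}$. The ordinary $L^2$-risk is $\mathsf{R}(\bar{\boldsymbol f}_n,\boldsymbol f_* )=\mathbb{E}_n\big[\|\bar{\boldsymbol f}_n-\boldsymbol f_*\|^2_{L^2(P_{\boldsymbol X})}\big]$. *)

theory Defs
  imports "HOL-Probability.Probability"
begin

definition cube :: "(real^2) set" where
  "cube = {x. \<forall>j. x $ j \<in> {-1..1}}"

definition bi_lipschitz_on :: "('a::real_normed_vector) set \<Rightarrow> ('a \<Rightarrow> 'b::real_normed_vector) \<Rightarrow> bool" where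
  "bi_lipschitz_on S f \<longleftrightarrow>
     (\<exists>L\<ge>1. \<forall>x\<in>S. \<forall>x'\<in>S.
        inverse L * norm (x - x') \<le> norm (f x - f x') \<and>
        norm (f x - f x') \<le> L * norm (x - x'))"

(* Maps are total functions of which only the restriction to the cube matters; all
   measures on the domain below live on the cube, so values outside play no role. *)
definition F_INV :: "(real^2 \<Rightarrow> real^2) set" where
  "F_INV = {f. bij_betw f cube cube \<and> bi_lipschitz_on cube f}"

abbreviation cube_borel :: "(real^2) measure" where
  "cube_borel \<equiv> restrict_space borel cube"

definition gauss_noise :: "real \<Rightarrow> (real^2) measure" where
  "gauss_noise \<sigma> = density lborel (\<lambda>e. ennreal (\<Prod>j\<in>UNIV. normal_density 0 \<sigma> (e $ j)))"

(* Law of one pair (X, f X + e) with X distributed as P and independent Gaussian noise e. *)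
definition obs_law :: "real \<Rightarrow> (real^2) measure \<Rightarrow> (real^2 \<Rightarrow> real^2) \<Rightarrow> ((real^2) \<times> (real^2)) measure" where
  "obs_law \<sigma> P f =
     distr (P \<Otimes>\<^sub>M gauss_noise \<sigma>) (cube_borel \<Otimes>\<^sub>M borel) (\<lambda>(x, e). (x, f x + e))"

definition sample_law :: "real \<Rightarrow> (real^2) measure \<Rightarrow> nat \<Rightarrow> (real^2 \<Rightarrow> real^2) \<Rightarrow>
    (nat \<Rightarrow> (real^2) \<times> (real^2)) measure" where
  "sample_law \<sigma> P n f = (\<Pi>\<^sub>M i\<in>{..<n}. obs_law \<sigma> P f)"

(* Measurability is joint in the sample and the evaluation point, so that the
   integrated squared error is a measurable function of the sample. *)
definition estimators :: "nat \<Rightarrow> ((nat \<Rightarrow> (real^2) \<times> (real^2)) \<Rightarrow> real^2 \<Rightarrow> real^2) set" where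
  "estimators n =
     {fhat. (\<lambda>(D, x). fhat D x) \<in>
        (\<Pi>\<^sub>M i\<in>{..<n}. cube_borel \<Otimes>\<^sub>M borel) \<Otimes>\<^sub>M cube_borel \<rightarrow>\<^sub>M borel}"

definition L2_norm_sq :: "(real^2) measure \<Rightarrow> (real^2 \<Rightarrow> real^2) \<Rightarrow> ennreal" where
  "L2_norm_sq P f = (\<Sum>j\<in>UNIV. \<integral>\<^sup>+x. ennreal (\<bar>f x $ j\<bar>\<^sup>2) \<partial>P)"

definition risk :: "real \<Rightarrow> (real^2) measure \<Rightarrow> nat \<Rightarrow>
    ((nat \<Rightarrow> (real^2) \<times> (real^2)) \<Rightarrow> real^2 \<Rightarrow> real^2) \<Rightarrow> (real^2 \<Rightarrow> real^2) \<Rightarrow> ennreal" where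
  "risk \<sigma> P n fhat f =
     (\<integral>\<^sup>+D. L2_norm_sq P (\<lambda>x. fhat D x - f x) \<partial>sample_law \<sigma> P n f)"

end

theory Submission
  imports Defs
begin

text \<open>
  The bound is Assouad's lemma for perturbations of the identity. Place \<open>m\<^sup>2\<close> disjoint conical
  bumps of height \<open>a/m\<close> on a grid in the cube and let \<open>f\<^sub>\<theta>\<close> move the first coordinate of \<open>x\<close> by the
  sum of the bumps selected by \<open>\<theta>\<close>. Since the sum has Lipschitz constant at most \<open>1/2\<close> and vanishes on the two
  sides \<open>\<bar>x\<^sub>1\<bar> = 1\<close>, every horizontal line is mapped monotonically onto itself and \<open>f\<^sub>\<theta>\<close> is a
  bi-Lipschitz bijection.

  For two parameters that differ in one bump \<open>\<phi>\<close> the sample likelihoods satisfy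
  \<open>\<integral> Q\<^sub>1\<^sup>2 / Q\<^sub>0 = (\<integral> exp (\<phi>\<^sup>2/\<sigma>\<^sup>2) dP)\<^sup>n\<close>, which is at most \<open>2\<close> when \<open>n \<le> m\<^sup>4\<close> and \<open>a\<close> is
  small, because the density of \<open>P\<close> is bounded. Then \<open>min Q\<^sub>0 Q\<^sub>1 \<ge> Q\<^sub>1 - Q\<^sub>1\<^sup>2 / (4 Q\<^sub>0)\<close> has
  integral at least \<open>1/2\<close>, so no estimator can tell the two apart. Averaging over all \<open>\<theta>\<close> bounds the worst risk below by a
  multiple of \<open>\<Sum> \<integral> \<phi>\<^sup>2 dP\<close>. The density of \<open>P\<close> need not be bounded away from zero, but it exceeds some
  \<open>\<delta> > 0\<close> outside a set of Lebesgue measure at most \<open>1/8\<close>, whereas the bumps are of order \<open>1/m\<close> on a set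
  of measure \<open>1/4\<close>, whatever \<open>m\<close> is.
\<close>

subsection \<open>Testing two hypotheses and Assouad's lemma\<close>

text \<open>Both hypotheses put weight at least \<open>min Q0 Q1\<close> on every outcome, and there
  the two losses add up to at least \<open>D\<close>; the bound on the second moment keeps the
  integral of this minimum at 1/2 or more. A second moment is used because it factorises over
  independent observations.\<close>

lemma two_point_bound:
  fixes Q0 Q1 :: "'a \<Rightarrow> real" and L0 L1 :: "'a \<Rightarrow> ennreal"
  assumes [measurable]: "Q0 \<in> borel_measurable M" "Q1 \<in> borel_measurable M"
      "L0 \<in> borel_measurable M" "L1 \<in> borel_measurable M"
    and pos: "\<And>x. Q0 x > 0" "\<And>x. Q1 x > 0"
    and one: "(\<integral>\<^sup>+x. ennreal (Q1 x) \<partial>M) = 1"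
    and chi: "(\<integral>\<^sup>+x. ennreal ((Q1 x)\<^sup>2 / Q0 x) \<partial>M) \<le> 2"
    and sep: "\<And>x. x \<in> space M \<Longrightarrow> D \<le> L0 x + L1 x"
  shows "D \<le> 2 * ((\<integral>\<^sup>+x. ennreal (Q0 x) * L0 x \<partial>M) + (\<integral>\<^sup>+x. ennreal (Q1 x) * L1 x \<partial>M))"
proof -
  let ?m = "\<lambda>x. ennreal (min (Q0 x) (Q1 x))"
  \<comment> \<open>If the minimum is \<open>Q0 x\<close>, this is the square
    \<open>(Q1 x / 2 - Q0 x)^2 >= 0\<close> divided by \<open>Q0 x\<close>; if it is
    \<open>Q1 x\<close>, the extra term is merely nonnegative.\<close>
  have pt: "Q1 x \<le> min (Q0 x) (Q1 x) + (1/4) * ((Q1 x)\<^sup>2 / Q0 x)" for x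
  proof -
    have "0 \<le> (Q1 x / 2 - Q0 x)\<^sup>2" by simp
    then have "Q1 x * Q0 x \<le> Q0 x * Q0 x + (1/4) * (Q1 x)\<^sup>2"
      by (simp add: power2_eq_square field_simps)
    then have "Q1 x \<le> Q0 x + (1/4) * ((Q1 x)\<^sup>2 / Q0 x)"
      using pos(1)[of x] by (simp add: field_simps)
    moreover have "0 \<le> (1/4) * ((Q1 x)\<^sup>2 / Q0 x)" using pos(1)[of x] by simp
    ultimately show ?thesis by (auto simp: min_def)
  qed
  have "1 \<le> (\<integral>\<^sup>+x. ?m x + ennreal (1/4) * ennreal ((Q1 x)\<^sup>2 / Q0 x) \<partial>M)"
    unfolding one[symmetric]
  proof (rule nn_integral_mono)
    fix x
    have "ennreal (Q1 x) \<le> ennreal (min (Q0 x) (Q1 x) + (1/4) * ((Q1 x)\<^sup>2 / Q0 x))"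
      using pt by (rule ennreal_leI)
    also have "\<dots> = ?m x + ennreal (1/4) * ennreal ((Q1 x)\<^sup>2 / Q0 x)"
      using pos[of x] ennreal_mult'[of "1/4" "(Q1 x)\<^sup>2 / Q0 x"]
      by (subst ennreal_plus) (auto simp: less_imp_le)
    finally show "ennreal (Q1 x) \<le> ?m x + ennreal (1/4) * ennreal ((Q1 x)\<^sup>2 / Q0 x)" .
  qed
  also have "\<dots> = (\<integral>\<^sup>+x. ?m x \<partial>M) + ennreal (1/4) * (\<integral>\<^sup>+x. ennreal ((Q1 x)\<^sup>2 / Q0 x) \<partial>M)"
    by (subst nn_integral_add) (auto simp: nn_integral_cmult)
  also have "\<dots> \<le> (\<integral>\<^sup>+x. ?m x \<partial>M) + ennreal (1/4) * 2"
    by (intro add_left_mono mult_left_mono chi) auto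
  also have "ennreal (1/4) * 2 = ennreal (1/2)"
    using ennreal_mult'[of "1/4" 2] by simp
  finally have *: "1 \<le> (\<integral>\<^sup>+x. ?m x \<partial>M) + ennreal (1/2)" .
  \<comment> \<open>Cancelling 1/2 needs a finite integral; an infinite one satisfies the claim at
    once.\<close>
  have m: "1 \<le> 2 * (\<integral>\<^sup>+x. ?m x \<partial>M)"
  proof (cases "(\<integral>\<^sup>+x. ?m x \<partial>M)" rule: ennreal_cases)
    case (real r)
    then have "1 \<le> ennreal (r + 1/2)" using * by (subst ennreal_plus) auto
    then have "1 \<le> r + 1/2" by (simp add: ennreal_ge_1)
    then have "1 \<le> ennreal (2 * r)" by (simp add: ennreal_ge_1)
    then show ?thesis using real by (simp add: ennreal_mult)
  qed (simp add: ennreal_mult_top)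
  have "D \<le> (2 * (\<integral>\<^sup>+x. ?m x \<partial>M)) * D"
    using mult_right_mono[OF m, of D] by simp
  also have "\<dots> = 2 * (\<integral>\<^sup>+x. ?m x * D \<partial>M)"
    by (subst nn_integral_multc) (auto simp: mult.assoc)
  also have "\<dots> \<le> 2 * (\<integral>\<^sup>+x. ennreal (Q0 x) * L0 x + ennreal (Q1 x) * L1 x \<partial>M)"
  proof (intro mult_left_mono nn_integral_mono)
    fix x assume x: "x \<in> space M"
    have "?m x * D \<le> ?m x * (L0 x + L1 x)" using sep[OF x] by (intro mult_left_mono) auto
    also have "\<dots> = ?m x * L0 x + ?m x * L1 x" by (simp add: distrib_left)
    also have "\<dots> \<le> ennreal (Q0 x) * L0 x + ennreal (Q1 x) * L1 x"
      by (intro add_mono mult_right_mono ennreal_leI) auto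
    finally show "?m x * D \<le> ennreal (Q0 x) * L0 x + ennreal (Q1 x) * L1 x" .
  qed auto
  also have "\<dots> = 2 * ((\<integral>\<^sup>+x. ennreal (Q0 x) * L0 x \<partial>M) + (\<integral>\<^sup>+x. ennreal (Q1 x) * L1 x \<partial>M))"
    by (subst nn_integral_add) auto
  finally show ?thesis .
qed

text \<open>Switching the membership of \<open>k\<close> is an involution of the power set.\<close>

lemma sum_Pow_sym_diff:
  fixes g :: "'k set \<Rightarrow> 'b::comm_monoid_add"
  assumes "k \<in> K"
  shows "(\<Sum>\<theta>\<in>Pow K. g (sym_diff \<theta> {k})) = sum g (Pow K)"
  by (rule sum.reindex_bij_witness[where i="\<lambda>\<theta>. sym_diff \<theta> {k}" and j="\<lambda>\<theta>. sym_diff \<theta> {k}"])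
    (use assms in auto)

text \<open>Summed over all vertices of the hypercube of subsets, each flipped term contributes the
  same total as the unflipped one, which gives the factor 2. Both sides carry the number of
  vertices, so the averaging needs only a final cancellation of a finite nonzero factor.\<close>

lemma assouad:
  fixes R :: "'k set \<Rightarrow> 'k \<Rightarrow> ennreal"
  assumes "finite K"
    and flip: "\<And>\<theta> k. \<theta> \<subseteq> K \<Longrightarrow> k \<in> K \<Longrightarrow> D k \<le> R \<theta> k + R (sym_diff \<theta> {k}) k"
    and total: "\<And>\<theta>. \<theta> \<subseteq> K \<Longrightarrow> (\<Sum>k\<in>K. R \<theta> k) \<le> S"
  shows "(\<Sum>k\<in>K. D k) \<le> 2 * S"
proof -
  let ?N = "of_nat (card (Pow K)) :: ennreal"
  have "?N * (\<Sum>k\<in>K. D k) = (\<Sum>k\<in>K. \<Sum>\<theta>\<in>Pow K. D k)"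
    by (simp add: sum_distrib_left)
  also have "\<dots> \<le> (\<Sum>k\<in>K. \<Sum>\<theta>\<in>Pow K. R \<theta> k + R (sym_diff \<theta> {k}) k)"
    by (intro sum_mono flip) auto
  also have "\<dots> = (\<Sum>k\<in>K. 2 * (\<Sum>\<theta>\<in>Pow K. R \<theta> k))"
    by (intro sum.cong refl) (simp add: sum.distrib sum_Pow_sym_diff[where g="\<lambda>\<theta>. R \<theta> _"] mult_2)
  also have "\<dots> = 2 * (\<Sum>\<theta>\<in>Pow K. \<Sum>k\<in>K. R \<theta> k)"
    by (subst sum.swap) (simp add: sum_distrib_left)
  also have "\<dots> \<le> 2 * (\<Sum>\<theta>\<in>Pow K. S)"
    by (intro mult_left_mono sum_mono total) auto
  also have "\<dots> = ?N * (2 * S)" by (simp add: mult_ac)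
  finally have le: "?N * (\<Sum>k\<in>K. D k) \<le> ?N * (2 * S)" .
  have "card (Pow K) > 0" using assms(1) by (simp add: card_Pow)
  then show ?thesis using le
    by (subst (asm) ennreal_mult_le_mult_iff) (auto simp: of_nat_eq_0_iff)
qed

text \<open>Both measures agree on boxes, where the integral of a product of one-coordinate
  functions factorises. Sigma-finiteness of the factors makes boxes sufficient. This serves to write
  the law of a sample as a density.\<close>

lemma (in product_sigma_finite) PiM_density:
  assumes I: "finite I" and f[measurable]: "\<And>i. i \<in> I \<Longrightarrow> f i \<in> borel_measurable (M i)"
    and sf: "\<And>i. sigma_finite_measure (density (M i) (f i))"
  shows "PiM I (\<lambda>i. density (M i) (f i)) = density (PiM I M) (\<lambda>x. \<Prod>i\<in>I. f i (x i))"
proof -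
  interpret D: product_sigma_finite "\<lambda>i. density (M i) (f i)"
    using sf by (rule product_sigma_finite.intro)
  show ?thesis
  proof (rule sym, rule D.PiM_eqI[OF I])
    show "sets (density (PiM I M) (\<lambda>x. \<Prod>i\<in>I. f i (x i))) = sets (PiM I (\<lambda>i. density (M i) (f i)))"
      by (simp cong: sets_PiM_cong)
  next
    fix A assume A: "\<And>i. i \<in> I \<Longrightarrow> A i \<in> sets (density (M i) (f i))"
    then have A'[measurable]: "\<And>i. i \<in> I \<Longrightarrow> A i \<in> sets (M i)" by simp
    have "emeasure (density (PiM I M) (\<lambda>x. \<Prod>i\<in>I. f i (x i))) (Pi\<^sub>E I A)
        = (\<integral>\<^sup>+x. (\<Prod>i\<in>I. f i (x i)) * indicator (Pi\<^sub>E I A) x \<partial>PiM I M)"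
      using I A' by (subst emeasure_density) (auto intro!: sets_PiM_I_finite)
    also have "\<dots> = (\<integral>\<^sup>+x. (\<Prod>i\<in>I. f i (x i) * indicator (A i) (x i)) \<partial>PiM I M)"
    proof (rule nn_integral_cong)
      fix x assume x: "x \<in> space (PiM I M)"
      \<comment> \<open>Points of the product space are extensional, so membership in the box is a
        condition on the coordinates in \<open>I\<close> alone.\<close>
      have "indicator (Pi\<^sub>E I A) x = (\<Prod>i\<in>I. indicator (A i) (x i) :: ennreal)"
        using x I by (cases "\<forall>i\<in>I. x i \<in> A i") (auto simp: indicator_def PiE_def space_PiM intro!: prod.neutral[symmetric])
      then show "(\<Prod>i\<in>I. f i (x i)) * indicator (Pi\<^sub>E I A) x = (\<Prod>i\<in>I. f i (x i) * indicator (A i) (x i))"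
        by (simp add: prod.distrib)
    qed
    also have "\<dots> = (\<Prod>i\<in>I. \<integral>\<^sup>+y. f i y * indicator (A i) y \<partial>M i)"
      using I by (subst product_nn_integral_prod) auto
    also have "\<dots> = (\<Prod>i\<in>I. emeasure (density (M i) (f i)) (A i))"
      by (intro prod.cong refl) (simp add: emeasure_density)
    finally show "emeasure (density (PiM I M) (\<lambda>x. \<Prod>i\<in>I. f i (x i))) (Pi\<^sub>E I A)
        = (\<Prod>i\<in>I. emeasure (density (M i) (f i)) (A i))" .
  qed
qed

subsection \<open>Gaussian observations\<close>

text \<open>The density inside \<open>gauss_noise\<close>, kept real-valued so that squares and
  likelihood ratios can be formed.\<close>

definition gauss_density :: "real \<Rightarrow> real^2 \<Rightarrow> real" where
  "gauss_density \<sigma> e = (\<Prod>j\<in>UNIV. normal_density 0 \<sigma> (e $ j))"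

lemma gauss_density_measurable[measurable]: "gauss_density \<sigma> \<in> borel_measurable borel"
  unfolding gauss_density_def by measurable

lemma gauss_density_pos: "\<sigma> > 0 \<Longrightarrow> gauss_density \<sigma> e > 0"
  unfolding gauss_density_def by (intro prod_pos) (auto intro: normal_density_pos)

text \<open>Passes to the \<open>Basis\<close> form of a product, in which Lebesgue integrals over
  the plane split into one-dimensional ones.\<close>

lemma prod_cart_Basis:
  fixes e :: "real^'n" and g :: "real \<Rightarrow> 'b::comm_monoid_mult"
  shows "(\<Prod>j\<in>UNIV. g (e $ j)) = (\<Prod>b\<in>Basis. g (e \<bullet> b))"
proof -
  have B: "(Basis :: (real^'n) set) = (\<lambda>i. axis i 1) ` UNIV"
    by (auto simp: Basis_vec_def)
  show ?thesis unfolding B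
    by (subst prod.reindex) (auto simp: inj_on_def axis_eq_axis inner_axis)
qed

lemma nn_integral_lborel_translate:
  fixes c :: "'a::euclidean_space"
  assumes [measurable]: "h \<in> borel_measurable borel"
  shows "(\<integral>\<^sup>+x. h (c + x) \<partial>lborel) = (\<integral>\<^sup>+x. h x \<partial>lborel)"
proof -
  have "(\<integral>\<^sup>+x. h x \<partial>lborel) = (\<integral>\<^sup>+x. h x \<partial>distr lborel borel ((+) c))"
    by (simp add: lborel_distr_plus)
  also have "\<dots> = (\<integral>\<^sup>+x. h (c + x) \<partial>lborel)"
    by (subst nn_integral_distr) auto
  finally show ?thesis by simp
qed

lemma nn_integral_gauss_density:
  assumes "\<sigma> > 0"
  shows "(\<integral>\<^sup>+y. ennreal (gauss_density \<sigma> (y - c)) \<partial>lborel) = 1"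
proof -
  have "(\<integral>\<^sup>+y. ennreal (gauss_density \<sigma> (y - c)) \<partial>lborel) = (\<integral>\<^sup>+y. ennreal (gauss_density \<sigma> y) \<partial>lborel)"
    using nn_integral_lborel_translate[of "\<lambda>y. ennreal (gauss_density \<sigma> y)" "-c"] by simp
  also have "\<dots> = (\<integral>\<^sup>+(y::real^2). (\<Prod>b\<in>Basis. ennreal (normal_density 0 \<sigma> (y \<bullet> b))) \<partial>lborel)"
    unfolding gauss_density_def
    by (simp add: prod_ennreal[symmetric] prod_cart_Basis[where g="\<lambda>t. ennreal (normal_density 0 \<sigma> t)"])
  also have "\<dots> = (\<Prod>b\<in>(Basis::(real^2) set). \<integral>\<^sup>+y. ennreal (normal_density 0 \<sigma> y) \<partial>lborel)"
    by (subst nn_integral_lborel_prod) auto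
  also have "(\<integral>\<^sup>+y. ennreal (normal_density 0 \<sigma> y) \<partial>lborel) = 1"
    using assms by (subst nn_integral_eq_integral) (auto simp: integral_normal_density)
  finally show ?thesis by simp
qed

text \<open>Completing the square: the squared density at \<open>b\<close> over the density at
  \<open>a\<close> is a constant times a Gaussian of the same variance, centred at the reflection
  \<open>2 * b - a\<close> of \<open>a\<close> in \<open>b\<close>.\<close>

lemma normal_density_sq:
  assumes "\<sigma> > 0"
  shows "(normal_density 0 \<sigma> (y - b))\<^sup>2 =
    exp ((a - b)\<^sup>2 / \<sigma>\<^sup>2) * normal_density 0 \<sigma> (y - (2 * b - a)) * normal_density 0 \<sigma> (y - a)"
proof -
  have "- (y - b)\<^sup>2 / (2 * \<sigma>\<^sup>2) + - (y - b)\<^sup>2 / (2 * \<sigma>\<^sup>2)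
      = (a - b)\<^sup>2 / \<sigma>\<^sup>2 + - (y - (2 * b - a))\<^sup>2 / (2 * \<sigma>\<^sup>2) + - (y - a)\<^sup>2 / (2 * \<sigma>\<^sup>2)"
    using assms by (simp add: divide_simps) (simp add: power2_eq_square algebra_simps)
  then have "exp (- (y - b)\<^sup>2 / (2 * \<sigma>\<^sup>2)) * exp (- (y - b)\<^sup>2 / (2 * \<sigma>\<^sup>2))
      = exp ((a - b)\<^sup>2 / \<sigma>\<^sup>2) * exp (- (y - (2 * b - a))\<^sup>2 / (2 * \<sigma>\<^sup>2)) * exp (- (y - a)\<^sup>2 / (2 * \<sigma>\<^sup>2))"
    by (metis exp_add)
  then show ?thesis
    unfolding normal_density_def power2_eq_square[of "_ * _"] by (simp add: mult_ac)
qed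

text \<open>The reflected Gaussian integrates to 1 over \<open>y\<close>, so only the exponential
  survives in the second moment of the likelihood ratio.\<close>

lemma gauss_density_sq_divide:
  fixes a b y :: "real^2"
  assumes "\<sigma> > 0"
  shows "(gauss_density \<sigma> (y - b))\<^sup>2 / gauss_density \<sigma> (y - a) =
    exp ((norm (a - b))\<^sup>2 / \<sigma>\<^sup>2) * gauss_density \<sigma> (y - (2 *\<^sub>R b - a))"
proof -
  have n: "(norm (a - b))\<^sup>2 = (a $ 1 - b $ 1)\<^sup>2 + (a $ 2 - b $ 2)\<^sup>2"
    by (simp add: norm_vec_def L2_set_def UNIV_2)
  have "(gauss_density \<sigma> (y - b))\<^sup>2 =
    exp ((norm (a - b))\<^sup>2 / \<sigma>\<^sup>2) * gauss_density \<sigma> (y - (2 *\<^sub>R b - a)) * gauss_density \<sigma> (y - a)"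
    unfolding gauss_density_def n add_divide_distrib exp_add
    by (simp add: UNIV_2 power_mult_distrib mult_ac
      normal_density_sq[OF assms, of "y $ 1" "b $ 1" "a $ 1"] normal_density_sq[OF assms, of "y $ 2" "b $ 2" "a $ 2"])
  then show ?thesis using gauss_density_pos[OF assms, of "y - a"] by (simp add: field_simps)
qed

lemma prob_space_gauss_noise: "\<sigma> > 0 \<Longrightarrow> prob_space (gauss_noise \<sigma>)"
  using nn_integral_gauss_density[of \<sigma> 0]
  by (intro prob_spaceI) (simp add: gauss_noise_def emeasure_density gauss_density_def cong: nn_integral_cong)

lemma sets_gauss_noise[measurable_cong]: "sets (gauss_noise \<sigma>) = sets borel"
  by (simp add: gauss_noise_def)

text \<open>For fixed \<open>x\<close> the noise is translated by \<open>f x\<close>, and Tonelli's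
  theorem collects the slices. The reference measure is independent of \<open>f\<close>, so
  different regression functions become comparable through their densities.\<close>

lemma obs_law_eq_density:
  assumes "\<sigma> > 0" and P: "prob_space P" "sets P = sets cube_borel"
    and f: "f \<in> borel_measurable cube_borel"
  shows "obs_law \<sigma> P f = density (P \<Otimes>\<^sub>M lborel) (\<lambda>(x, y). ennreal (gauss_density \<sigma> (y - f x)))"
proof -
  interpret P: prob_space P by fact
  interpret G: prob_space "gauss_noise \<sigma>" using assms(1) by (rule prob_space_gauss_noise)
  note [measurable_cong] = P(2)
  have f'[measurable]: "f \<in> borel_measurable P" using f P(2) by (simp cong: measurable_cong_sets)
  have sp: "sets (P \<Otimes>\<^sub>M lborel) = sets (cube_borel \<Otimes>\<^sub>M borel)"
    by (rule sets_pair_measure_cong) (auto simp: P(2))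
  show ?thesis
  proof (rule measure_eqI)
    show "sets (obs_law \<sigma> P f) = sets (density (P \<Otimes>\<^sub>M lborel) (\<lambda>(x, y). ennreal (gauss_density \<sigma> (y - f x))))"
      by (simp only: obs_law_def sets_distr sets_density sp)
  next
    fix A assume "A \<in> sets (obs_law \<sigma> P f)"
    then have A0: "A \<in> sets (cube_borel \<Otimes>\<^sub>M borel)" by (simp add: obs_law_def)
    then have A[measurable]: "A \<in> sets (P \<Otimes>\<^sub>M borel)" 
      by (metis P(2) sets_pair_measure_cong)
    have T: "(\<lambda>(x, e). (x, f x + e)) \<in> P \<Otimes>\<^sub>M gauss_noise \<sigma> \<rightarrow>\<^sub>M cube_borel \<Otimes>\<^sub>M borel"
      by (simp add: measurable_cong_sets[OF refl sp[symmetric]])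
    have "emeasure (obs_law \<sigma> P f) A = (\<integral>\<^sup>+z. indicator A z \<partial>obs_law \<sigma> P f)"
      using A0 by (simp add: obs_law_def)
    also have "\<dots> = (\<integral>\<^sup>+z. indicator A (case z of (x, e) \<Rightarrow> (x, f x + e)) \<partial>(P \<Otimes>\<^sub>M gauss_noise \<sigma>))"
      unfolding obs_law_def using A0 by (subst nn_integral_distr[OF T]) auto
    also have "\<dots> = (\<integral>\<^sup>+x. \<integral>\<^sup>+e. indicator A (x, f x + e) \<partial>gauss_noise \<sigma> \<partial>P)"
      by (subst G.nn_integral_fst[symmetric]) auto
    also have "\<dots> = (\<integral>\<^sup>+x. \<integral>\<^sup>+y. ennreal (gauss_density \<sigma> (y - f x)) * indicator A (x, y) \<partial>lborel \<partial>P)"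
    proof (rule nn_integral_cong)
      fix x assume x: "x \<in> space P"
      then have [measurable]: "(\<lambda>y. indicator A (x, y) :: ennreal) \<in> borel_measurable borel" by simp
      have "(\<integral>\<^sup>+e. indicator A (x, f x + e) \<partial>gauss_noise \<sigma>)
          = (\<integral>\<^sup>+e. ennreal (gauss_density \<sigma> e) * indicator A (x, f x + e) \<partial>lborel)"
        unfolding gauss_noise_def gauss_density_def[symmetric]
        by (subst nn_integral_density) auto
      also have "\<dots> = (\<integral>\<^sup>+y. ennreal (gauss_density \<sigma> (y - f x)) * indicator A (x, y) \<partial>lborel)"
        using nn_integral_lborel_translate[of "\<lambda>y. ennreal (gauss_density \<sigma> (y - f x)) * indicator A (x, y)" "f x"]
        by simp
      finally show "(\<integral>\<^sup>+e. indicator A (x, f x + e) \<partial>gauss_noise \<sigma>)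
          = (\<integral>\<^sup>+y. ennreal (gauss_density \<sigma> (y - f x)) * indicator A (x, y) \<partial>lborel)" .
    qed
    also have "\<dots> = (\<integral>\<^sup>+z. (case z of (x, y) \<Rightarrow> ennreal (gauss_density \<sigma> (y - f x))) * indicator A z \<partial>(P \<Otimes>\<^sub>M lborel))"
      by (subst lborel.nn_integral_fst[symmetric]) auto
    also have "\<dots> = emeasure (density (P \<Otimes>\<^sub>M lborel) (\<lambda>(x, y). ennreal (gauss_density \<sigma> (y - f x)))) A"
      using A0 by (subst emeasure_density) (auto simp: sp)
    finally show "emeasure (obs_law \<sigma> P f) A
        = emeasure (density (P \<Otimes>\<^sub>M lborel) (\<lambda>(x, y). ennreal (gauss_density \<sigma> (y - f x)))) A" .
  qed
qed

subsection \<open>Perturbations of the identity\<close>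

text \<open>A cone of slope \<open>a\<close> over the ball of radius \<open>r\<close>: its Lipschitz
  constant stays fixed when the radius shrinks with the grid.\<close>

definition bump :: "real \<Rightarrow> real \<Rightarrow> 'a::metric_space \<Rightarrow> 'a \<Rightarrow> real" where
  "bump a r c x = a * max 0 (r - dist x c)"

lemma bump_nonneg: "a \<ge> 0 \<Longrightarrow> bump a r c x \<ge> 0"
  by (simp add: bump_def)

lemma bump_le: "a \<ge> 0 \<Longrightarrow> r \<ge> 0 \<Longrightarrow> bump a r c x \<le> a * r"
  unfolding bump_def by (intro mult_left_mono) auto

lemma bump_outside: "r \<le> dist x c \<Longrightarrow> bump a r c x = 0"
  by (simp add: bump_def)

lemma bump_lipschitz:
  assumes "a \<ge> 0"
  shows "\<bar>bump a r c x - bump a r c y\<bar> \<le> a * dist x y"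
proof -
  have "\<bar>max 0 (r - dist x c) - max 0 (r - dist y c)\<bar> \<le> dist x y"
    using dist_triangle[of x c y] dist_triangle[of y c x] by (auto simp: max_def dist_commute)
  then have "a * \<bar>max 0 (r - dist x c) - max 0 (r - dist y c)\<bar> \<le> a * dist x y"
    using assms by (rule mult_left_mono)
  then show ?thesis
    using assms unfolding bump_def by (simp add: abs_mult flip: right_diff_distrib)
qed

lemma sum_eq_one_term:
  fixes u :: "'k \<Rightarrow> real"
  assumes "finite \<theta>" and "\<And>k l. k \<in> \<theta> \<Longrightarrow> l \<in> \<theta> \<Longrightarrow> k \<noteq> l \<Longrightarrow> u k = 0 \<or> u l = 0"
  shows "sum u \<theta> = 0 \<or> (\<exists>k\<in>\<theta>. sum u \<theta> = u k)"
proof (cases "\<exists>k\<in>\<theta>. u k \<noteq> 0")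
  case True
  then obtain k where k: "k \<in> \<theta>" "u k \<noteq> 0" by blast
  then have "sum u (\<theta> - {k}) = 0" using assms(2) by (intro sum.neutral) auto
  then have "sum u \<theta> = u k" using k assms(1) by (simp add: sum.remove)
  then show ?thesis using k by blast
qed (auto intro: sum.neutral)

text \<open>Comparing \<open>x\<close> and \<open>y\<close> in different supports costs the Lipschitz constant of both functions,
  hence the factor \<open>2\<close>.\<close>
lemma lipschitz_sum_disjoint:
  fixes u :: "'k \<Rightarrow> 'a::metric_space \<Rightarrow> real"
  assumes fin: "finite \<theta>" and nn: "\<And>k x. k \<in> \<theta> \<Longrightarrow> 0 \<le> u k x"
    and lip: "\<And>k x y. k \<in> \<theta> \<Longrightarrow> \<bar>u k x - u k y\<bar> \<le> a * dist x y"
    and disj: "\<And>k l x. k \<in> \<theta> \<Longrightarrow> l \<in> \<theta> \<Longrightarrow> k \<noteq> l \<Longrightarrow> u k x = 0 \<or> u l x = 0"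
    and a: "0 \<le> a"
  shows "\<bar>(\<Sum>k\<in>\<theta>. u k x) - (\<Sum>k\<in>\<theta>. u k y)\<bar> \<le> 2 * a * dist x y"
proof -
  \<comment> \<open>At \<open>x\<close> at most one summand is nonzero, and at \<open>y\<close> the
    whole sum is at least the same summand because all terms are nonnegative. Exchanging
    \<open>x\<close> and \<open>y\<close> gives the other direction.\<close>
  have one_sided: "(\<Sum>k\<in>\<theta>. u k x) - (\<Sum>k\<in>\<theta>. u k y) \<le> a * dist x y" for x y
  proof -
    have "(\<Sum>k\<in>\<theta>. u k x) = 0 \<or> (\<exists>k\<in>\<theta>. (\<Sum>k\<in>\<theta>. u k x) = u k x)"
      using sum_eq_one_term[OF fin, of "\<lambda>k. u k x"] disj by blast
    then show ?thesis
    proof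
      assume "(\<Sum>k\<in>\<theta>. u k x) = 0"
      moreover have "0 \<le> (\<Sum>k\<in>\<theta>. u k y)" using nn by (intro sum_nonneg) auto
      moreover have "0 \<le> a * dist x y" using a by simp
      ultimately show ?thesis by linarith
    next
      assume "\<exists>k\<in>\<theta>. (\<Sum>k\<in>\<theta>. u k x) = u k x"
      then obtain k where k: "k \<in> \<theta>" "(\<Sum>k\<in>\<theta>. u k x) = u k x" by blast
      have "u k y \<le> (\<Sum>k\<in>\<theta>. u k y)" using k nn fin by (intro member_le_sum) auto
      then show ?thesis using k lip[of k x y] by auto
    qed
  qed
  have "0 \<le> a * dist x y" using a by simp
  then show ?thesis using one_sided[of x y] one_sided[of y x] by (auto simp: dist_commute)
qed

section \<open>Shears along the first coordinate\<close>

definition shear :: "(real^2 \<Rightarrow> real) \<Rightarrow> real^2 \<Rightarrow> real^2" where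
  "shear g x = x + g x *\<^sub>R axis 1 1"

lemma shear_nth[simp]: "shear g x $ 1 = x $ 1 + g x" "shear g x $ 2 = x $ 2"
  by (auto simp: shear_def axis_def)

text \<open>A perturbation with Lipschitz constant 1/2 changes distances by a factor between 1/2 and
  3/2, hence also injectivity. As the ends of every horizontal segment stay fixed, the intermediate
  value theorem on that segment gives surjectivity.\<close>

lemma shear_in_F_INV:
  assumes lip: "\<And>x y. \<bar>g x - g y\<bar> \<le> 1/2 * norm (x - y)"
    and bd: "\<And>x. \<bar>x $ 1\<bar> = 1 \<Longrightarrow> g x = 0"
  shows "shear g \<in> F_INV"
proof -
  have diff: "norm ((shear g x - shear g y) - (x - y)) \<le> 1/2 * norm (x - y)" for x y
  proof -
    have "(shear g x - shear g y) - (x - y) = (g x - g y) *\<^sub>R axis 1 1"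
      by (simp add: shear_def algebra_simps)
    then show ?thesis using lip by simp
  qed
  have lo: "1/2 * norm (x - y) \<le> norm (shear g x - shear g y)" for x y
    using diff[of x y] norm_triangle_ineq2[of "x - y" "shear g x - shear g y"] 
    by (simp add: norm_minus_commute)
  have hi: "norm (shear g x - shear g y) \<le> 2 * norm (x - y)" for x y
    using diff[of x y] norm_triangle_ineq2[of "shear g x - shear g y" "x - y"] norm_ge_zero[of "x - y"] by linarith
  have bil: "bi_lipschitz_on cube (shear g)"
    unfolding bi_lipschitz_on_def using lo hi by (intro exI[of _ 2]) (auto simp: inverse_eq_divide)
  have inj: "inj_on (shear g) cube"
  proof (rule inj_onI)
    fix x y assume "shear g x = shear g y"
    then show "x = y" using lo[of x y] by simp
  qed
  have into: "shear g x \<in> cube" if x: "x \<in> cube" for x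
  proof -
    \<comment> \<open>Compare \<open>x\<close> with the point \<open>z\<close> of the side
      \<open>s\<close> at the same height: the shift is at most half the distance to either side, so
      it cannot leave the cube.\<close>
    have *: "\<bar>g x\<bar> \<le> 1/2 * \<bar>x $ 1 - s\<bar>" if s: "\<bar>s\<bar> = 1" for s
    proof -
      define z :: "real^2" where "z = vector [s, x $ 2]"
      have "x - z = (x $ 1 - s) *\<^sub>R axis 1 1"
        by (simp add: z_def vec_eq_iff forall_2 axis_def)
      then have "norm (x - z) = \<bar>x $ 1 - s\<bar>" by simp
      moreover have "g z = 0" using s by (intro bd) (simp add: z_def)
      ultimately show ?thesis using lip[of x z] by simp
    qed
    show ?thesis using x *[of 1] *[of "-1"] by (auto simp: cube_def forall_2)
  qed
  have surj: "y \<in> shear g ` cube" if y: "y \<in> cube" for y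
  proof -
    \<comment> \<open>The horizontal line through \<open>y\<close>, on which a preimage of
      \<open>y\<close> is sought.\<close>
    let ?v = "\<lambda>t::real. vector [t, y $ 2] :: real^2"
    have v: "norm (?v t - ?v s) = \<bar>t - s\<bar>" for t s
    proof -
      have "?v t - ?v s = (t - s) *\<^sub>R axis 1 1" by (simp add: vec_eq_iff forall_2 axis_def)
      then show ?thesis by simp
    qed
    have "continuous_on {-1..1} (\<lambda>t. g (?v t))"
    proof (rule continuous_onI)
      fix t e :: real assume e: "e > 0"
      have "dist (g (?v t')) (g (?v t)) \<le> e" if "dist t' t < e" for t'
      proof -
        have "dist (g (?v t')) (g (?v t)) \<le> 1/2 * dist t' t"
          using lip[of "?v t'" "?v t"] unfolding v dist_real_def .
        then show ?thesis using that zero_le_dist[of t' t] by linarith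
      qed
      then show "\<exists>d>0. \<forall>t'\<in>{- 1..1}. dist t' t < d \<longrightarrow> dist (g (?v t')) (g (?v t)) \<le> e"
        using e by blast
    qed
    then have "continuous_on {-1..1} (\<lambda>t. t + g (?v t))" by (intro continuous_intros)
    moreover have "g (?v (-1)) = 0" "g (?v 1) = 0" by (auto intro!: bd)
    moreover have "-1 \<le> y $ 1" "y $ 1 \<le> 1" using y by (auto simp: cube_def)
    ultimately obtain t where t: "-1 \<le> t" "t \<le> 1" "t + g (?v t) = y $ 1"
      using IVT'[of "\<lambda>t. t + g (?v t)" "-1" "y $ 1" 1] by auto
    then have "shear g (?v t) = y" by (simp add: vec_eq_iff forall_2)
    moreover have "?v t \<in> cube" using t y by (auto simp: cube_def forall_2)
    ultimately show ?thesis by (metis image_eqI)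
  qed
  show ?thesis using bil inj into surj by (auto simp: F_INV_def bij_betw_def)
qed

section \<open>Bumps on the grid of \<open>m\<close> by \<open>m\<close> squares of side
  \<open>2 / m\<close> that tile the cube\<close>

definition grid_center :: "nat \<Rightarrow> nat \<times> nat \<Rightarrow> real^2" where
  "grid_center m k = vector [-1 + (2 * real (fst k) + 1) / real m, -1 + (2 * real (snd k) + 1) / real m]"

lemma grid_center_separated:
  assumes m: "m > 0" and "k \<noteq> l"
  shows "2 / real m \<le> \<bar>grid_center m k $ 1 - grid_center m l $ 1\<bar>
    \<or> 2 / real m \<le> \<bar>grid_center m k $ 2 - grid_center m l $ 2\<bar>"
proof -
  have *: "2 / real m \<le> \<bar>(-1 + (2 * real i + 1) / real m) - (-1 + (2 * real j + 1) / real m)\<bar>"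
    if "i \<noteq> j" for i j :: nat
  proof -
    have "(-1 + (2 * real i + 1) / real m) - (-1 + (2 * real j + 1) / real m) = 2 * (real i - real j) / real m"
      by (simp add: algebra_simps diff_divide_distrib add_divide_distrib)
    moreover have "1 \<le> \<bar>real i - real j\<bar>" using that by linarith
    ultimately show ?thesis using m by (simp add: abs_mult divide_right_mono)
  qed
  show ?thesis using assms(2) *[of "fst k" "fst l"] *[of "snd k" "snd l"]
    by (cases "fst k = fst l") (auto simp: grid_center_def prod_eq_iff)
qed

lemma dist_grid_center:
  assumes "m > 0" "k \<noteq> l"
  shows "2 / real m \<le> dist (grid_center m k) (grid_center m l)"
  using grid_center_separated[OF assms] dist_vec_nth_le[of "grid_center m k" 1 "grid_center m l"]
    dist_vec_nth_le[of "grid_center m k" 2 "grid_center m l"]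
  unfolding dist_real_def by linarith

text \<open>The margin \<open>1 / real m\<close> is the bump radius, which makes the bumps vanish on
  the sides of the cube.\<close>

lemma grid_center_bound:
  assumes "k \<in> {..<m} \<times> {..<m}"
  shows "\<bar>grid_center m k $ j\<bar> \<le> 1 - 1 / real m"
proof -
  have *: "\<bar>-1 + (2 * real i + 1) / real m\<bar> \<le> 1 - 1 / real m" if "i < m" for i
  proof -
    have "real i + 1 \<le> real m" using that by linarith
    then show ?thesis using that by (auto simp: abs_le_iff field_simps)
  qed
  have "\<forall>j. \<bar>grid_center m k $ j\<bar> \<le> 1 - 1 / real m"
    using assms *[of "fst k"] *[of "snd k"] unfolding forall_2 grid_center_def
    by (auto simp only: vector_2 mem_Times_iff lessThan_iff)
  then show ?thesis by blast
qed

text \<open>The centres are at least two radii apart. Tangent balls are harmless because a bump is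
  zero on its bounding circle.\<close>

lemma grid_bump_disjoint:
  assumes "m > 0" "k \<noteq> l"
  shows "bump a (1 / real m) (grid_center m k) x = 0 \<or> bump a (1 / real m) (grid_center m l) x = 0"
  using dist_grid_center[OF assms] dist_triangle[of "grid_center m k" "grid_center m l" x]
    bump_outside[of "1 / real m" x "grid_center m k" a] bump_outside[of "1 / real m" x "grid_center m l" a]
  by (simp add: dist_commute) linarith

definition perturbed_id :: "real \<Rightarrow> nat \<Rightarrow> (nat \<times> nat) set \<Rightarrow> real^2 \<Rightarrow> real^2" where
  "perturbed_id a m \<theta> = shear (\<lambda>x. \<Sum>k\<in>\<theta>. bump a (1 / real m) (grid_center m k) x)"

text \<open>The cap 1/4 on \<open>a\<close> turns the Lipschitz bound \<open>2 * a\<close> of the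
  sum into the 1/2 that shears tolerate.\<close>

lemma perturbed_id_in_F_INV:
  assumes a: "0 \<le> a" "a \<le> 1/4" and m: "m > 0" and \<theta>: "\<theta> \<subseteq> {..<m} \<times> {..<m}"
  shows "perturbed_id a m \<theta> \<in> F_INV"
  unfolding perturbed_id_def
proof (rule shear_in_F_INV)
  let ?u = "\<lambda>k. bump a (1 / real m) (grid_center m k)"
  have fin: "finite \<theta>" using \<theta> by (rule finite_subset) auto
  fix x y :: "real^2"
  have "\<bar>(\<Sum>k\<in>\<theta>. ?u k x) - (\<Sum>k\<in>\<theta>. ?u k y)\<bar> \<le> 2 * a * dist x y"
    by (rule lipschitz_sum_disjoint[OF fin])
      (use a m grid_bump_disjoint in \<open>auto intro: bump_nonneg bump_lipschitz\<close>)
  also have "\<dots> \<le> 1/2 * norm (x - y)"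
    unfolding dist_norm using a by (intro mult_right_mono) auto
  finally show "\<bar>(\<Sum>k\<in>\<theta>. ?u k x) - (\<Sum>k\<in>\<theta>. ?u k y)\<bar> \<le> 1/2 * norm (x - y)" .
next
  fix x :: "real^2" assume x: "\<bar>x $ 1\<bar> = 1"
  show "(\<Sum>k\<in>\<theta>. bump a (1 / real m) (grid_center m k) x) = 0"
  proof (intro sum.neutral ballI bump_outside)
    fix k assume "k \<in> \<theta>"
    then have "\<bar>grid_center m k $ 1\<bar> \<le> 1 - 1 / real m" using \<theta> by (intro grid_center_bound) auto
    then have "1 / real m \<le> dist (x $ 1) (grid_center m k $ 1)" using x by (auto simp: dist_real_def)
    then show "1 / real m \<le> dist x (grid_center m k)" using dist_vec_nth_le order_trans by blast
  qed
qed

text \<open>All other bumps cancel, and adding or removing \<open>k\<close> affects only the sign.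
  The distance between neighbouring hypotheses therefore does not depend on \<theta>.\<close>

lemma norm_perturbed_id_flip:
  assumes "a \<ge> 0" "finite \<theta>"
  shows "norm (perturbed_id a m \<theta> x - perturbed_id a m (sym_diff \<theta> {k}) x) = bump a (1 / real m) (grid_center m k) x"
proof -
  let ?u = "\<lambda>k. bump a (1 / real m) (grid_center m k) x"
  have d: "\<bar>sum ?u \<theta> - sum ?u (sym_diff \<theta> {k})\<bar> = ?u k"
  proof (cases "k \<in> \<theta>")
    case True
    then have "sym_diff \<theta> {k} = \<theta> - {k}" by auto
    then show ?thesis using True assms by (simp add: sum.remove bump_nonneg)
  next
    case False
    then have "sym_diff \<theta> {k} = insert k \<theta>" by auto
    then show ?thesis using False assms by (simp add: bump_nonneg)
  qed
  have "perturbed_id a m \<theta> x - perturbed_id a m (sym_diff \<theta> {k}) x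
      = (sum ?u \<theta> - sum ?u (sym_diff \<theta> {k})) *\<^sub>R axis 1 1"
    by (simp add: perturbed_id_def shear_def algebra_simps)
  then show ?thesis using d by simp
qed

lemma F_INV_measurable:
  assumes "f \<in> F_INV"
  shows "f \<in> borel_measurable cube_borel"
proof (rule borel_measurable_continuous_on_restrict)
  from assms obtain L where L: "L \<ge> 1" "\<And>x y. x \<in> cube \<Longrightarrow> y \<in> cube \<Longrightarrow> norm (f x - f y) \<le> L * norm (x - y)"
    by (auto simp: F_INV_def bi_lipschitz_on_def)
  then have "L-lipschitz_on cube f" by (intro lipschitz_onI) (auto simp: dist_norm)
  then show "continuous_on cube f" by (rule lipschitz_on_continuous_on)
qed

subsection \<open>Bumps under the design distribution\<close>

lemma cube_eq_cbox: "cube = cbox (vec (-1)) (vec 1)"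
  by (auto simp: cube_def mem_box_cart)

lemma cube_borel_set[measurable]: "cube \<in> sets borel"
  by (simp add: cube_eq_cbox)

text \<open>Closed balls of the maximum norm, which are boxes and so have an explicit
  volume.\<close>

definition sup_ball :: "real^'n \<Rightarrow> real \<Rightarrow> (real^'n) set" where
  "sup_ball c s = {x. \<forall>j. \<bar>x $ j - c $ j\<bar> \<le> s}"

lemma sup_ball_eq_cbox: "sup_ball c s = cbox (c - vec s) (c + vec s)"
  by (auto simp: sup_ball_def mem_box_cart abs_le_iff algebra_simps)

lemma sup_ball_borel[measurable]: "sup_ball c s \<in> sets borel"
  by (simp add: sup_ball_eq_cbox)

lemma emeasure_sup_ball:
  fixes c :: "real^2"
  assumes "s \<ge> 0"
  shows "emeasure lborel (sup_ball c s) = ennreal (4 * s\<^sup>2)"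
proof -
  have ne: "cbox (c - vec s) (c + vec s) \<noteq> {}"
    using assms by (auto simp: mem_box_cart intro!: exI[of _ c] simp flip: ex_in_conv)
  have "emeasure lborel (sup_ball c s) = ennreal (measure lborel (cbox (c - vec s) (c + vec s)))"
    unfolding sup_ball_eq_cbox
    by (rule emeasure_eq_ennreal_measure) (use emeasure_lborel_cbox_finite in \<open>auto simp: less_top\<close>)
  also have "measure lborel (cbox (c - vec s) (c + vec s)) = 4 * s\<^sup>2"
    using content_cbox_cart[OF ne] assms by (simp add: UNIV_2 power2_eq_square)
  finally show ?thesis .
qed

text \<open>The Euclidean norm is at most the sum of the two coordinate distances, hence the factor
  2.\<close>

lemma dist_le_sup_ball:
  fixes x :: "real^2"
  assumes "x \<in> sup_ball c s" shows "dist x c \<le> 2 * s"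
proof -
  have "norm (x - c) \<le> (\<Sum>j\<in>UNIV. \<bar>(x - c) $ j\<bar>)" by (rule norm_le_l1_cart)
  also have "\<dots> \<le> (\<Sum>j\<in>(UNIV::2 set). s)"
    using assms by (intro sum_mono) (auto simp: sup_ball_def)
  finally show ?thesis by (simp add: dist_norm)
qed

lemma bump_measurable[measurable]: "bump a r (c :: real^2) \<in> borel_measurable borel"
  unfolding bump_def by measurable

lemma borel_measurable_vec_nth[measurable (raw)]:
  fixes f :: "'a \<Rightarrow> real^'n"
  assumes "f \<in> borel_measurable M"
  shows "(\<lambda>x. f x $ j) \<in> borel_measurable M"
  using borel_measurable_inner[OF assms borel_measurable_const[of "axis j 1"]]
  by (simp add: inner_axis)

section \<open>Design distributions with a positive bounded density\<close>

locale cube_density = prob_space P for P :: "(real^2) measure" +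
  fixes p :: "real^2 \<Rightarrow> real" and B :: real
  assumes p_meas[measurable]: "p \<in> borel_measurable cube_borel"
    and P_eq: "P = density (restrict_space lborel cube) (\<lambda>x. ennreal (p x))"
    and p_pos: "x \<in> cube \<Longrightarrow> p x > 0"
    and p_le: "x \<in> cube \<Longrightarrow> p x \<le> B"
begin

lemma sets_P[measurable_cong]: "sets P = sets cube_borel"
  unfolding P_eq by (simp add: sets_restrict_space)

lemma space_P: "space P = cube"
  unfolding P_eq by (simp add: space_restrict_space)

lemma p_meas'[measurable]: "p \<in> borel_measurable (restrict_space lborel cube)"
  using p_meas by (simp cong: measurable_cong_sets add: sets_restrict_space)

lemma sets_restrict_cube: "A \<in> sets borel \<Longrightarrow> A \<subseteq> cube \<Longrightarrow> A \<in> sets (restrict_space lborel cube)"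
  by (simp add: sets_restrict_space_iff)

lemma emeasure_P:
  assumes "A \<in> sets borel" "A \<subseteq> cube"
  shows "emeasure P A = (\<integral>\<^sup>+x. ennreal (p x) * indicator A x \<partial>restrict_space lborel cube)"
  unfolding P_eq using sets_restrict_cube[OF assms] by (subst emeasure_density) auto

lemma emeasure_cube_restrict:
  assumes "A \<in> sets borel" "A \<subseteq> cube"
  shows "emeasure (restrict_space lborel cube) A = emeasure lborel A"
  using assms by (subst emeasure_restrict_space) auto

lemma emeasure_P_le:
  assumes A: "A \<in> sets borel" "A \<subseteq> cube"
  shows "emeasure P A \<le> ennreal B * emeasure lborel A"
proof -
  have "emeasure P A \<le> (\<integral>\<^sup>+x. ennreal B * indicator A x \<partial>restrict_space lborel cube)"
    unfolding emeasure_P[OF A] using p_le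
    by (intro nn_integral_mono mult_right_mono ennreal_leI) (auto simp: space_restrict_space)
  also have "\<dots> = ennreal B * emeasure lborel A"
    using sets_restrict_cube[OF A] emeasure_cube_restrict[OF A] by (simp add: nn_integral_cmult)
  finally show ?thesis .
qed

text \<open>The sets where \<open>p\<close> is below \<open>inverse (real (Suc i))\<close> decrease
  to the empty set, so by continuity from above one of them has volume less than 1/8. Any
  \<open>A\<close> of volume 1/4 keeps at least 1/8 outside it, which makes \<kappa> uniform in
  \<open>A\<close>.\<close>

lemma emeasure_P_lower_bound:
  obtains \<kappa> where "\<kappa> > 0"
    "\<And>A. A \<in> sets borel \<Longrightarrow> A \<subseteq> cube \<Longrightarrow> emeasure lborel A = ennreal (1/4) \<Longrightarrow> ennreal \<kappa> \<le> emeasure P A"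
proof -
  let ?R = "restrict_space lborel cube"
  define N where "N i = {x\<in>space ?R. p x < inverse (real (Suc i))}" for i
  have N[measurable]: "N i \<in> sets ?R" for i unfolding N_def by measurable
  have "(\<lambda>i. emeasure ?R (N i)) \<longlonglongrightarrow> emeasure ?R (\<Inter>i. N i)"
  proof (rule Lim_emeasure_decseq)
    show "decseq N"
    proof (rule decseq_SucI)
      fix i
      have "inverse (real (Suc (Suc i))) \<le> inverse (real (Suc i))" by (intro le_imp_inverse_le) auto
      then show "N (Suc i) \<subseteq> N i" unfolding N_def by (blast intro: less_le_trans)
    qed
    have "emeasure ?R (N i) \<le> emeasure ?R cube" for i
      by (intro emeasure_mono) (auto simp: N_def space_restrict_space sets_restrict_space_iff)
    moreover have "emeasure ?R cube < \<infinity>"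
      using emeasure_cube_restrict[of cube] emeasure_lborel_cbox_finite by (simp add: cube_eq_cbox)
    ultimately show "emeasure ?R (N i) \<noteq> \<infinity>" for i
      by (metis infinity_ennreal_def leD top.not_eq_extremum)
  qed auto
  moreover have "(\<Inter>i. N i) = {}"
  proof (rule ccontr)
    assume "(\<Inter>i. N i) \<noteq> {}"
    then obtain x where x: "\<And>i. x \<in> N i" by blast
    then have "0 < p x" using p_pos by (auto simp: N_def space_restrict_space)
    then obtain i where "inverse (real (Suc i)) < p x" using reals_Archimedean by blast
    then show False using x[of i] by (simp add: N_def)
  qed
  ultimately have "(\<lambda>i. emeasure ?R (N i)) \<longlonglongrightarrow> 0" by simp
  then have "eventually (\<lambda>i. emeasure ?R (N i) < ennreal (1/8)) sequentially"
    by (rule order_tendstoD(2)) (simp add: zero_less_iff_neq_zero)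
  then obtain i where i: "emeasure ?R (N i) < ennreal (1/8)"
    by (auto simp: eventually_sequentially)
  define \<delta> where "\<delta> = inverse (real (Suc i))"
  have \<delta>: "\<delta> > 0" by (simp add: \<delta>_def)
  have "ennreal (\<delta> * (1/8)) \<le> emeasure P A"
    if A: "A \<in> sets borel" "A \<subseteq> cube" "emeasure lborel A = ennreal (1/4)" for A
  proof -
    have A'[measurable]: "A \<in> sets ?R" by (rule sets_restrict_cube[OF A(1,2)])
    have "ennreal (1/8) + ennreal (1/8) = emeasure ?R A"
      using A by (simp add: emeasure_cube_restrict flip: ennreal_plus)
    also have "\<dots> \<le> emeasure ?R ((A - N i) \<union> N i)" by (intro emeasure_mono) auto
    also have "\<dots> \<le> emeasure ?R (A - N i) + emeasure ?R (N i)" by (intro emeasure_subadditive) auto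
    also have "\<dots> \<le> emeasure ?R (A - N i) + ennreal (1/8)" using i by (intro add_left_mono) auto
    finally have "ennreal (1/8) \<le> emeasure ?R (A - N i)"
      by (simp add: ennreal_add_left_cancel_le add.commute)
    then have "ennreal (\<delta> * (1/8)) \<le> ennreal \<delta> * emeasure ?R (A - N i)"
      using \<delta> by (subst ennreal_mult) (auto intro!: mult_left_mono)
    also have "\<dots> = (\<integral>\<^sup>+x. ennreal \<delta> * indicator (A - N i) x \<partial>?R)"
      by (simp add: nn_integral_cmult)
    also have "\<dots> \<le> emeasure P A"
      unfolding emeasure_P[OF A(1,2)]
      by (intro nn_integral_mono)
        (auto simp: N_def \<delta>_def not_less indicator_def intro!: ennreal_leI)
    finally show ?thesis .
  qed
  then show thesis using that[of "\<delta> * (1/8)"] \<delta> by simp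
qed

lemma bump_measurable_P[measurable]: "bump a r c \<in> borel_measurable P"
  using measurable_restrict_space1[OF bump_measurable] sets_P by (simp cong: measurable_cong_sets)

text \<open>The power \<open>r^4\<close> combines the squared height \<open>(a * r)^2\<close> with
  the volume \<open>4 * r^2\<close> of a box around the support.\<close>

lemma nn_integral_exp_bump_le:
  fixes c :: "real^2"
  assumes a: "0 \<le> a" and r: "0 \<le> r" and s: "\<sigma> > 0" and ar: "a * r \<le> \<sigma>" and B: "B \<ge> 0"
  shows "(\<integral>\<^sup>+x. ennreal (exp ((bump a r c x)\<^sup>2 / \<sigma>\<^sup>2)) \<partial>P) \<le> ennreal (1 + 8 * a\<^sup>2 * B / \<sigma>\<^sup>2 * r^4)"
proof -
  let ?A = "sup_ball c r \<inter> cube"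
  let ?t = "(a * r)\<^sup>2 / \<sigma>\<^sup>2"
  \<comment> \<open>Off the ball the exponential is 1. On it the exponent is at most
    \<open>?t\<close>, and \<open>exp ?t <= 1 + ?t + ?t^2 <= 1 + 2 * ?t\<close> because
    \<open>a * r\<close> does not exceed \<sigma>.\<close>
  have pt: "exp ((bump a r c x)\<^sup>2 / \<sigma>\<^sup>2) \<le> 1 + 2 * ?t * indicator ?A x" if x: "x \<in> cube" for x
  proof (cases "dist x c < r")
    case True
    have "\<bar>x $ j - c $ j\<bar> \<le> r" for j
      using dist_vec_nth_le[of x j c] True by (simp add: dist_real_def)
    then have "x \<in> ?A" using x by (simp add: sup_ball_def)
    moreover have le: "(bump a r c x)\<^sup>2 / \<sigma>\<^sup>2 \<le> ?t"
      using bump_le[OF a r, of c x] bump_nonneg[OF a, of r c x] by (intro divide_right_mono power_mono) auto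
    moreover have "?t \<le> 1" using ar a r s power_mono[OF ar, of 2] by (simp add: divide_le_eq)
    ultimately have "exp ((bump a r c x)\<^sup>2 / \<sigma>\<^sup>2) \<le> 1 + ?t + ?t\<^sup>2"
      using exp_bound[of ?t] by (meson exp_le_cancel_iff order_trans divide_nonneg_nonneg zero_le_power2)
    also have "?t\<^sup>2 \<le> ?t"
      using \<open>?t \<le> 1\<close> unfolding power2_eq_square[of ?t] by (intro mult_left_le) auto
    finally show ?thesis using \<open>x \<in> ?A\<close> by simp
  next
    case False
    then show ?thesis by (simp add: bump_outside)
  qed
  have A: "?A \<in> sets borel" "?A \<subseteq> cube" by auto
  have A'[measurable]: "?A \<in> sets P" using A by (simp add: sets_P sets_restrict_space_iff)
  have "(\<integral>\<^sup>+x. ennreal (exp ((bump a r c x)\<^sup>2 / \<sigma>\<^sup>2)) \<partial>P) \<le> (\<integral>\<^sup>+x. 1 + ennreal (2 * ?t) * indicator ?A x \<partial>P)"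
  proof (rule nn_integral_mono)
    fix x assume "x \<in> space P"
    then have "ennreal (exp ((bump a r c x)\<^sup>2 / \<sigma>\<^sup>2)) \<le> ennreal (1 + 2 * ?t * indicator ?A x)"
      by (intro ennreal_leI pt) (simp add: space_P)
    also have "\<dots> = 1 + ennreal (2 * ?t) * indicator ?A x"
      by (cases "x \<in> ?A") (simp_all add: ennreal_plus)
    finally show "ennreal (exp ((bump a r c x)\<^sup>2 / \<sigma>\<^sup>2)) \<le> 1 + ennreal (2 * ?t) * indicator ?A x" .
  qed
  also have "\<dots> = 1 + ennreal (2 * ?t) * emeasure P ?A"
    by (subst nn_integral_add) (auto simp: nn_integral_cmult emeasure_space_1)
  also have "\<dots> \<le> 1 + ennreal (2 * ?t) * (ennreal B * ennreal (4 * r\<^sup>2))"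
  proof (intro add_left_mono mult_left_mono order_trans[OF emeasure_P_le[OF A]])
    have "emeasure lborel ?A \<le> emeasure lborel (sup_ball c r)" by (intro emeasure_mono) auto
    then show "emeasure lborel ?A \<le> ennreal (4 * r\<^sup>2)" using r by (simp add: emeasure_sup_ball)
  qed auto
  also have "\<dots> = ennreal (1 + 2 * ?t * (B * (4 * r\<^sup>2)))"
  proof -
    have "ennreal (2 * ?t * (B * (4 * r\<^sup>2))) = ennreal (2 * ?t) * (ennreal B * ennreal (4 * r\<^sup>2))"
      using B by (subst ennreal_mult, simp, simp) (subst ennreal_mult, auto)
    moreover have "0 \<le> 2 * ?t * (B * (4 * r\<^sup>2))" using B by simp
    ultimately show ?thesis by (metis ennreal_1 ennreal_plus zero_le_one)
  qed
  also have "1 + 2 * ?t * (B * (4 * r\<^sup>2)) = 1 + 8 * a\<^sup>2 * B / \<sigma>\<^sup>2 * r^4"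
    by (simp add: power_mult_distrib power4_eq_xxxx power2_eq_square)
  finally show ?thesis .
qed

lemma sum_nn_integral_bump_sq_ge:
  assumes a: "0 \<le> a" and m: "m > 0"
    and \<kappa>: "\<And>A. A \<in> sets borel \<Longrightarrow> A \<subseteq> cube \<Longrightarrow> emeasure lborel A = ennreal (1/4) \<Longrightarrow> ennreal \<kappa> \<le> emeasure P A"
    and "\<kappa> \<ge> 0"
  shows "ennreal ((a / (2 * real m))\<^sup>2 * \<kappa>)
    \<le> (\<Sum>k\<in>{..<m} \<times> {..<m}. \<integral>\<^sup>+x. ennreal ((bump a (1 / real m) (grid_center m k) x)\<^sup>2) \<partial>P)"
proof -
  let ?K = "{..<m} \<times> {..<m}"
  define r where "r = 1 / real m"
  have r: "r > 0" using m by (simp add: r_def)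
  \<comment> \<open>Radius \<open>r / 4\<close> in the maximum norm stays within Euclidean distance
    \<open>r / 2\<close> of the centre, where the bump has at least half its height. The
    \<open>m^2\<close> boxes have total volume 1/4 for every \<open>m\<close>, as required by
    \<kappa>.\<close>
  let ?S = "\<lambda>k. sup_ball (grid_center m k) (r / 4)"
  let ?U = "\<Union>k\<in>?K. ?S k"
  have disj: "disjoint_family_on ?S ?K"
    unfolding disjoint_family_on_def
  proof (intro ballI impI)
    fix k l :: "nat \<times> nat" assume "k \<noteq> l"
    show "?S k \<inter> ?S l = {}"
    proof (rule ccontr)
      assume "?S k \<inter> ?S l \<noteq> {}"
      then obtain x where "x \<in> ?S k" "x \<in> ?S l" by blast
      then have "dist x (grid_center m k) \<le> 2 * (r / 4)" "dist x (grid_center m l) \<le> 2 * (r / 4)"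
        by (blast intro: dist_le_sup_ball)+
      moreover have "2 * r \<le> dist (grid_center m k) (grid_center m l)"
        using dist_grid_center[OF m \<open>k \<noteq> l\<close>] by (simp add: r_def)
      ultimately show False
        using dist_triangle3[of "grid_center m k" "grid_center m l" x] r
        unfolding dist_commute[of x] by linarith
    qed
  qed
  have sub: "?S k \<subseteq> cube" if "k \<in> ?K" for k
  proof
    fix x assume x: "x \<in> ?S k"
    have "\<bar>x $ j\<bar> \<le> 1" for j
    proof -
      have "\<bar>x $ j - grid_center m k $ j\<bar> \<le> r / 4" using x by (simp add: sup_ball_def)
      then show ?thesis using grid_center_bound[OF that, of j] r unfolding r_def[symmetric] by linarith
    qed
    then show "x \<in> cube" unfolding cube_def by (simp add: abs_le_iff minus_le_iff)
  qed
  have [measurable]: "?S k \<in> sets P" if "k \<in> ?K" for k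
    using sub[OF that] by (simp add: sets_P sets_restrict_space_iff)
  have "emeasure lborel ?U = (\<Sum>k\<in>?K. emeasure lborel (?S k))"
    using disj by (intro sum_emeasure[symmetric]) auto
  also have "\<dots> = (\<Sum>k\<in>?K. ennreal (4 * (r / 4)\<^sup>2))"
    using r by (simp add: emeasure_sup_ball)
  also have "\<dots> = ennreal (\<Sum>k\<in>?K. 4 * (r / 4)\<^sup>2)" by (rule sum_ennreal) auto
  also have "(\<Sum>k\<in>?K. 4 * (r / 4)\<^sup>2) = 1/4"
    using m by (simp add: card_cartesian_product r_def power2_eq_square)
  finally have "ennreal \<kappa> \<le> emeasure P ?U" using sub by (intro \<kappa>) auto
  also have "\<dots> = (\<Sum>k\<in>?K. emeasure P (?S k))"
    using disj by (intro sum_emeasure[symmetric]) auto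
  finally have "ennreal ((a * r / 2)\<^sup>2) * ennreal \<kappa> \<le> ennreal ((a * r / 2)\<^sup>2) * (\<Sum>k\<in>?K. emeasure P (?S k))"
    by (rule mult_left_mono) simp
  also have "\<dots> = (\<Sum>k\<in>?K. \<integral>\<^sup>+x. ennreal ((a * r / 2)\<^sup>2) * indicator (?S k) x \<partial>P)"
    unfolding sum_distrib_left by (intro sum.cong refl) (simp add: nn_integral_cmult)
  also have "\<dots> \<le> (\<Sum>k\<in>?K. \<integral>\<^sup>+x. ennreal ((bump a r (grid_center m k) x)\<^sup>2) \<partial>P)"
  proof (intro sum_mono nn_integral_mono)
    fix k x
    show "ennreal ((a * r / 2)\<^sup>2) * indicator (?S k) x \<le> ennreal ((bump a r (grid_center m k) x)\<^sup>2)"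
    proof (cases "x \<in> ?S k")
      case True
      then have "dist x (grid_center m k) \<le> r / 2" using dist_le_sup_ball by fastforce
      then have "a * (r / 2) \<le> bump a r (grid_center m k) x"
        unfolding bump_def using a by (intro mult_left_mono) (auto simp: le_max_iff_disj)
      then have "(a * r / 2)\<^sup>2 \<le> (bump a r (grid_center m k) x)\<^sup>2"
        using a r by (intro power_mono) auto
      then show ?thesis using True by (simp add: ennreal_leI)
    qed simp
  qed
  finally show ?thesis using \<open>\<kappa> \<ge> 0\<close> by (simp add: r_def ennreal_mult mult.commute[of 2])
qed

end

subsection \<open>Likelihoods and risk\<close>

text \<open>The density of the sample law with respect to the product of copies of \<open>P\<close>
  and Lebesgue measure, so the density of the design does not enter.\<close>

definition likelihood :: "real \<Rightarrow> nat \<Rightarrow> (real^2 \<Rightarrow> real^2) \<Rightarrow> (nat \<Rightarrow> (real^2) \<times> (real^2)) \<Rightarrow> real" where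
  "likelihood \<sigma> n f D = (\<Prod>i<n. gauss_density \<sigma> (snd (D i) - f (fst (D i))))"

text \<open>Only the first coordinate counts because shears differ only there. Restricting to a set
  \<open>A\<close> lets the losses on separate bumps add up to at most the full loss.\<close>

definition local_loss :: "(real^2) measure \<Rightarrow> (real^2) set \<Rightarrow> (real^2 \<Rightarrow> real^2) \<Rightarrow> (real^2 \<Rightarrow> real^2) \<Rightarrow> ennreal" where
  "local_loss P A u v = (\<integral>\<^sup>+x. ennreal ((u x $ 1 - v x $ 1)\<^sup>2) * indicator A x \<partial>P)"

lemma likelihood_pos: "\<sigma> > 0 \<Longrightarrow> likelihood \<sigma> n f D > 0"
  unfolding likelihood_def by (intro prod_pos) (auto intro: gauss_density_pos)

section \<open>Sample laws as densities over a common base measure\<close>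

context cube_density begin

abbreviation base :: "((real^2) \<times> (real^2)) measure" where
  "base \<equiv> P \<Otimes>\<^sub>M lborel"

lemma sets_base: "sets base = sets (cube_borel \<Otimes>\<^sub>M borel)"
  by (rule sets_pair_measure_cong) (auto simp: sets_P)

lemma sigma_finite_base: "sigma_finite_measure base"
proof -
  interpret pair_sigma_finite P lborel ..
  show ?thesis ..
qed

lemma product_sigma_finite_base: "product_sigma_finite (\<lambda>i::nat. base)"
  by (intro product_sigma_finite.intro sigma_finite_base)

lemma measurable_P: "f \<in> borel_measurable cube_borel \<Longrightarrow> f \<in> borel_measurable P"
  using sets_P by (simp cong: measurable_cong_sets)

lemma measurable_gauss_shift:
  assumes f: "f \<in> borel_measurable cube_borel"
  shows "(\<lambda>z. gauss_density \<sigma> (snd z - f (fst z))) \<in> borel_measurable base"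
proof -
  note [measurable] = measurable_P[OF f]
  show ?thesis by measurable
qed

lemma likelihood_measurable:
  assumes f: "f \<in> borel_measurable cube_borel"
  shows "likelihood \<sigma> n f \<in> borel_measurable (PiM {..<n} (\<lambda>_. base))"
proof -
  note [measurable] = measurable_gauss_shift[OF f]
  show ?thesis unfolding likelihood_def by measurable
qed

lemma obs_law_eq_density_base:
  assumes "\<sigma> > 0" and f: "f \<in> borel_measurable cube_borel"
  shows "obs_law \<sigma> P f = density base (\<lambda>z. ennreal (gauss_density \<sigma> (snd z - f (fst z))))"
  using obs_law_eq_density[OF assms(1) prob_space_axioms sets_P f] by (simp add: case_prod_unfold)

lemma nn_integral_gauss_shift:
  assumes "\<sigma> > 0" and f: "f \<in> borel_measurable cube_borel"
  shows "(\<integral>\<^sup>+z. ennreal (gauss_density \<sigma> (snd z - f (fst z))) \<partial>base) = 1"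
proof -
  note [measurable] = measurable_gauss_shift[OF f]
  have "(\<integral>\<^sup>+z. ennreal (gauss_density \<sigma> (snd z - f (fst z))) \<partial>base)
      = (\<integral>\<^sup>+x. \<integral>\<^sup>+y. ennreal (gauss_density \<sigma> (y - f x)) \<partial>lborel \<partial>P)"
    by (subst lborel.nn_integral_fst[symmetric]) auto
  then show ?thesis
    using nn_integral_gauss_density[OF assms(1)] by (simp add: emeasure_space_1)
qed

lemma sample_law_eq_density:
  assumes s: "\<sigma> > 0" and f: "f \<in> borel_measurable cube_borel"
  shows "sample_law \<sigma> P n f = density (PiM {..<n} (\<lambda>_. base)) (\<lambda>D. ennreal (likelihood \<sigma> n f D))"
proof -
  interpret product_sigma_finite "\<lambda>i::nat. base" by (rule product_sigma_finite_base)
  note [measurable] = measurable_gauss_shift[OF f]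
  let ?q = "\<lambda>z. ennreal (gauss_density \<sigma> (snd z - f (fst z)))"
  have "prob_space (density base ?q)"
    using nn_integral_gauss_shift[OF s f]
    by (intro prob_spaceI) (subst emeasure_density; simp cong del: sets_pair_measure_cong cong: nn_integral_cong)
  then have "sigma_finite_measure (density base ?q)"
    using finite_measure.axioms(1) prob_space.axioms(1) by blast
  then have "sample_law \<sigma> P n f = density (PiM {..<n} (\<lambda>_. base)) (\<lambda>D. \<Prod>i<n. ?q (D i))"
    unfolding sample_law_def obs_law_eq_density_base[OF s f] by (intro PiM_density) auto
  then show ?thesis
    using gauss_density_pos[OF s] by (simp add: likelihood_def prod_ennreal less_imp_le)
qed

lemma nn_integral_likelihood:
  assumes s: "\<sigma> > 0" and f: "f \<in> borel_measurable cube_borel"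
  shows "(\<integral>\<^sup>+D. ennreal (likelihood \<sigma> n f D) \<partial>PiM {..<n} (\<lambda>_. base)) = 1"
proof -
  interpret product_sigma_finite "\<lambda>i::nat. base" by (rule product_sigma_finite_base)
  note [measurable] = measurable_gauss_shift[OF f]
  have "(\<integral>\<^sup>+D. ennreal (likelihood \<sigma> n f D) \<partial>PiM {..<n} (\<lambda>_. base))
      = (\<integral>\<^sup>+D. (\<Prod>i<n. ennreal (gauss_density \<sigma> (snd (D i) - f (fst (D i))))) \<partial>PiM {..<n} (\<lambda>_. base))"
    using gauss_density_pos[OF s] by (simp add: likelihood_def prod_ennreal less_imp_le)
  also have "\<dots> = 1"
    by (subst product_nn_integral_prod) (auto simp: nn_integral_gauss_shift[OF s f])
  finally show ?thesis .
qed

text \<open>Integrating out the response first removes the reflected Gaussian; independence of the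
  observations then turns the product into a power.\<close>

lemma nn_integral_likelihood_sq_divide:
  assumes s: "\<sigma> > 0" and f: "f \<in> borel_measurable cube_borel" and g: "g \<in> borel_measurable cube_borel"
  shows "(\<integral>\<^sup>+D. ennreal ((likelihood \<sigma> n g D)\<^sup>2 / likelihood \<sigma> n f D) \<partial>PiM {..<n} (\<lambda>_. base))
    = (\<integral>\<^sup>+x. ennreal (exp ((norm (f x - g x))\<^sup>2 / \<sigma>\<^sup>2)) \<partial>P) ^ n"
proof -
  interpret product_sigma_finite "\<lambda>i::nat. base" by (rule product_sigma_finite_base)
  note [measurable] = measurable_gauss_shift[OF f] measurable_gauss_shift[OF g] measurable_P[OF f] measurable_P[OF g]
  let ?q = "\<lambda>f z. gauss_density \<sigma> (snd z - f (fst z))"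
  have "(\<integral>\<^sup>+z. ennreal ((?q g z)\<^sup>2 / ?q f z) \<partial>base)
      = (\<integral>\<^sup>+x. \<integral>\<^sup>+y. ennreal ((gauss_density \<sigma> (y - g x))\<^sup>2 / gauss_density \<sigma> (y - f x)) \<partial>lborel \<partial>P)"
    by (subst lborel.nn_integral_fst[symmetric]) auto
  also have "\<dots> = (\<integral>\<^sup>+x. ennreal (exp ((norm (f x - g x))\<^sup>2 / \<sigma>\<^sup>2)) \<partial>P)"
    by (simp add: gauss_density_sq_divide[OF s] ennreal_mult' nn_integral_cmult nn_integral_gauss_density[OF s])
  finally have one: "(\<integral>\<^sup>+z. ennreal ((?q g z)\<^sup>2 / ?q f z) \<partial>base)
      = (\<integral>\<^sup>+x. ennreal (exp ((norm (f x - g x))\<^sup>2 / \<sigma>\<^sup>2)) \<partial>P)" .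
  have "(\<integral>\<^sup>+D. ennreal ((likelihood \<sigma> n g D)\<^sup>2 / likelihood \<sigma> n f D) \<partial>PiM {..<n} (\<lambda>_. base))
      = (\<integral>\<^sup>+D. (\<Prod>i<n. ennreal ((?q g (D i))\<^sup>2 / ?q f (D i))) \<partial>PiM {..<n} (\<lambda>_. base))"
    using gauss_density_pos[OF s]
    by (simp add: likelihood_def prod_ennreal less_imp_le prod_dividef prod_power_distrib)
  also have "\<dots> = (\<integral>\<^sup>+x. ennreal (exp ((norm (f x - g x))\<^sup>2 / \<sigma>\<^sup>2)) \<partial>P) ^ n"
    by (subst product_nn_integral_prod) (auto simp: one)
  finally show ?thesis .
qed

section \<open>Local losses of an estimator\<close>

lemma estimator_measurable:
  assumes "fhat \<in> estimators n"
  shows "(\<lambda>(D, x). fhat D x) \<in> borel_measurable (PiM {..<n} (\<lambda>_. base) \<Otimes>\<^sub>M P)"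
proof -
  have "sets (PiM {..<n} (\<lambda>_. base) \<Otimes>\<^sub>M P)
      = sets ((\<Pi>\<^sub>M i\<in>{..<n}. cube_borel \<Otimes>\<^sub>M borel) \<Otimes>\<^sub>M cube_borel)"
    by (intro sets_pair_measure_cong sets_PiM_cong sets_P refl sets_base)
  then show ?thesis
    using assms measurable_cong_sets[OF _ refl] unfolding estimators_def by blast
qed

lemma local_loss_measurable:
  assumes "fhat \<in> estimators n" and f: "f \<in> borel_measurable cube_borel" and [measurable]: "A \<in> sets P"
  shows "(\<lambda>D. local_loss P A (fhat D) f) \<in> borel_measurable (PiM {..<n} (\<lambda>_. base))"
proof -
  note [measurable] = estimator_measurable[OF assms(1)] measurable_P[OF f]
  show ?thesis unfolding local_loss_def by measurable
qed

lemma nn_integral_sample_law: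
  assumes "\<sigma> > 0" "f \<in> borel_measurable cube_borel" "h \<in> borel_measurable (PiM {..<n} (\<lambda>_. base))"
  shows "(\<integral>\<^sup>+D. h D \<partial>sample_law \<sigma> P n f) = (\<integral>\<^sup>+D. ennreal (likelihood \<sigma> n f D) * h D \<partial>PiM {..<n} (\<lambda>_. base))"
  unfolding sample_law_eq_density[OF assms(1,2)]
  using assms likelihood_measurable[OF assms(2)] by (subst nn_integral_density) auto

text \<open>The constant 4 is the 2 of \<open>two_point_bound\<close> times the 2 of the relaxed
  triangle inequality for squares, which is why the losses enter doubled.\<close>

lemma local_loss_two_points:
  assumes s: "\<sigma> > 0" and fhat: "fhat \<in> estimators n"
    and f: "f \<in> borel_measurable cube_borel" and g: "g \<in> borel_measurable cube_borel" and A: "A \<in> sets P"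
    and chi: "(\<integral>\<^sup>+x. ennreal (exp ((norm (f x - g x))\<^sup>2 / \<sigma>\<^sup>2)) \<partial>P) ^ n \<le> 2"
  shows "local_loss P A f g \<le> 4 * ((\<integral>\<^sup>+D. local_loss P A (fhat D) f \<partial>sample_law \<sigma> P n f)
    + (\<integral>\<^sup>+D. local_loss P A (fhat D) g \<partial>sample_law \<sigma> P n g))"
proof -
  note meas[measurable] = local_loss_measurable[OF fhat f A] local_loss_measurable[OF fhat g A]
  note [measurable] = likelihood_measurable[OF f] likelihood_measurable[OF g] measurable_P[OF f] measurable_P[OF g] A
  let ?M = "PiM {..<n} (\<lambda>_. base)"
  have "local_loss P A f g \<le> 2 * ((\<integral>\<^sup>+D. ennreal (likelihood \<sigma> n f D) * (2 * local_loss P A (fhat D) f) \<partial>?M)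
    + (\<integral>\<^sup>+D. ennreal (likelihood \<sigma> n g D) * (2 * local_loss P A (fhat D) g) \<partial>?M))"
  proof (rule two_point_bound)
    fix D assume D: "D \<in> space ?M"
    have [measurable]: "fhat D \<in> borel_measurable P"
      using measurable_Pair2[OF estimator_measurable[OF fhat] D] by simp
    have "local_loss P A f g \<le> (\<integral>\<^sup>+x. 2 * (ennreal ((fhat D x $ 1 - f x $ 1)\<^sup>2) * indicator A x)
        + 2 * (ennreal ((fhat D x $ 1 - g x $ 1)\<^sup>2) * indicator A x) \<partial>P)"
      unfolding local_loss_def
    proof (rule nn_integral_mono)
      fix x
      \<comment> \<open>The right side minus the left side is the square of
        \<open>(w - u) + (w - v)\<close>.\<close>
      have sq: "(u - v)\<^sup>2 \<le> 2 * (w - u)\<^sup>2 + 2 * (w - v)\<^sup>2" for u v w :: real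
      proof -
        have "0 \<le> ((w - u) + (w - v))\<^sup>2" by simp
        then show ?thesis by (simp add: power2_eq_square algebra_simps)
      qed
      have "ennreal ((f x $ 1 - g x $ 1)\<^sup>2)
          \<le> ennreal (2 * (fhat D x $ 1 - f x $ 1)\<^sup>2 + 2 * (fhat D x $ 1 - g x $ 1)\<^sup>2)"
        by (intro ennreal_leI sq)
      also have "\<dots> = 2 * ennreal ((fhat D x $ 1 - f x $ 1)\<^sup>2) + 2 * ennreal ((fhat D x $ 1 - g x $ 1)\<^sup>2)"
        by (subst ennreal_plus) (auto simp: ennreal_mult)
      finally show "ennreal ((f x $ 1 - g x $ 1)\<^sup>2) * indicator A x
        \<le> 2 * (ennreal ((fhat D x $ 1 - f x $ 1)\<^sup>2) * indicator A x)
        + 2 * (ennreal ((fhat D x $ 1 - g x $ 1)\<^sup>2) * indicator A x)"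
        by (cases "x \<in> A") auto
    qed
    also have "\<dots> = 2 * local_loss P A (fhat D) f + 2 * local_loss P A (fhat D) g"
      unfolding local_loss_def by (subst nn_integral_add) (auto simp: nn_integral_cmult)
    finally show "local_loss P A f g \<le> 2 * local_loss P A (fhat D) f + 2 * local_loss P A (fhat D) g" .
  next
    show "(\<integral>\<^sup>+D. ennreal ((likelihood \<sigma> n g D)\<^sup>2 / likelihood \<sigma> n f D) \<partial>?M) \<le> 2"
      using chi by (simp add: nn_integral_likelihood_sq_divide[OF s f g])
  qed (use likelihood_pos[OF s] nn_integral_likelihood[OF s g] in auto)
  also have "(\<integral>\<^sup>+D. ennreal (likelihood \<sigma> n f D) * (2 * local_loss P A (fhat D) f) \<partial>?M)
      = 2 * (\<integral>\<^sup>+D. local_loss P A (fhat D) f \<partial>sample_law \<sigma> P n f)"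
    unfolding nn_integral_sample_law[OF s f meas(1)]
    by (subst nn_integral_cmult[symmetric]) (auto intro!: nn_integral_cong simp only: mult.left_commute, measurable)
  also have "(\<integral>\<^sup>+D. ennreal (likelihood \<sigma> n g D) * (2 * local_loss P A (fhat D) g) \<partial>?M)
      = 2 * (\<integral>\<^sup>+D. local_loss P A (fhat D) g \<partial>sample_law \<sigma> P n g)"
    unfolding nn_integral_sample_law[OF s g meas(2)]
    by (subst nn_integral_cmult[symmetric]) (auto intro!: nn_integral_cong simp only: mult.left_commute, measurable)
  also have "2 * (2 * u + 2 * v) = 4 * (u + v)" for u v :: ennreal
    by (simp add: distrib_left flip: mult.assoc)
  finally show ?thesis .
qed

text \<open>On disjoint sets the indicators sum to at most 1, so the local losses together are
  bounded by the first-coordinate part of the integrated error.\<close>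

lemma sum_local_loss_le_risk:
  assumes s: "\<sigma> > 0" and fhat: "fhat \<in> estimators n" and f: "f \<in> borel_measurable cube_borel"
    and K: "finite K" and A: "\<And>k. k \<in> K \<Longrightarrow> A k \<in> sets P" and disj: "disjoint_family_on A K"
  shows "(\<Sum>k\<in>K. \<integral>\<^sup>+D. local_loss P (A k) (fhat D) f \<partial>sample_law \<sigma> P n f) \<le> risk \<sigma> P n fhat f"
proof -
  have sets: "sets (sample_law \<sigma> P n f) = sets (PiM {..<n} (\<lambda>_. base))"
    by (simp add: sample_law_eq_density[OF s f])
  have "(\<Sum>k\<in>K. \<integral>\<^sup>+D. local_loss P (A k) (fhat D) f \<partial>sample_law \<sigma> P n f)
      = (\<integral>\<^sup>+D. (\<Sum>k\<in>K. local_loss P (A k) (fhat D) f) \<partial>sample_law \<sigma> P n f)"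
    using local_loss_measurable[OF fhat f A]
    by (intro nn_integral_sum[symmetric]) (simp cong: measurable_cong_sets add: sets)
  also have "\<dots> \<le> risk \<sigma> P n fhat f"
    unfolding risk_def
  proof (rule nn_integral_mono)
    fix D assume "D \<in> space (sample_law \<sigma> P n f)"
    then have D: "D \<in> space (PiM {..<n} (\<lambda>_. base))" using sets_eq_imp_space_eq[OF sets] by simp
    have [measurable]: "fhat D \<in> borel_measurable P"
      using measurable_Pair2[OF estimator_measurable[OF fhat] D] by simp
    note [measurable] = measurable_P[OF f]
    have "(\<Sum>k\<in>K. local_loss P (A k) (fhat D) f)
        = (\<integral>\<^sup>+x. (\<Sum>k\<in>K. ennreal ((fhat D x $ 1 - f x $ 1)\<^sup>2) * indicator (A k) x) \<partial>P)"
      unfolding local_loss_def using A by (intro nn_integral_sum[symmetric]) auto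
    also have "\<dots> \<le> (\<integral>\<^sup>+x. ennreal (\<bar>(fhat D x - f x) $ 1\<bar>\<^sup>2) \<partial>P)"
    proof (rule nn_integral_mono)
      fix x
      have "(\<Sum>k\<in>K. ennreal ((fhat D x $ 1 - f x $ 1)\<^sup>2) * indicator (A k) x)
          = ennreal ((fhat D x $ 1 - f x $ 1)\<^sup>2) * indicator (\<Union>k\<in>K. A k) x"
        unfolding sum_distrib_left[symmetric] using K disj by (simp add: indicator_UN_disjoint)
      also have "\<dots> \<le> ennreal (\<bar>(fhat D x - f x) $ 1\<bar>\<^sup>2)"
        by (auto simp: indicator_def)
      finally show "(\<Sum>k\<in>K. ennreal ((fhat D x $ 1 - f x $ 1)\<^sup>2) * indicator (A k) x)
          \<le> ennreal (\<bar>(fhat D x - f x) $ 1\<bar>\<^sup>2)" .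
    qed
    also have "\<dots> \<le> L2_norm_sq P (\<lambda>x. fhat D x - f x)"
      unfolding L2_norm_sq_def UNIV_2 by simp
    finally show "(\<Sum>k\<in>K. local_loss P (A k) (fhat D) f) \<le> L2_norm_sq P (\<lambda>x. fhat D x - f x)" .
  qed
  finally show ?thesis .
qed

section \<open>The minimax lower bound\<close>

lemma sup_risk_lower_bound:
  assumes s: "\<sigma> > 0" and fhat: "fhat \<in> estimators n" and a: "0 \<le> a" "a \<le> 1/4" and m: "m > 0"
    and chi: "\<And>c. (\<integral>\<^sup>+x. ennreal (exp ((bump a (1 / real m) c x)\<^sup>2 / \<sigma>\<^sup>2)) \<partial>P) ^ n \<le> 2"
  shows "(\<Sum>k\<in>{..<m} \<times> {..<m}. \<integral>\<^sup>+x. ennreal ((bump a (1 / real m) (grid_center m k) x)\<^sup>2) \<partial>P)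
    \<le> 8 * (SUP f\<in>F_INV. risk \<sigma> P n fhat f)"
proof -
  let ?K = "{..<m} \<times> {..<m}"
  let ?u = "\<lambda>k. bump a (1 / real m) (grid_center m k)"
  let ?S = "SUP f\<in>F_INV. risk \<sigma> P n fhat f"
  let ?f = "perturbed_id a m"
  define A where "A k = {x\<in>space P. ?u k x \<noteq> 0}" for k
  have A[measurable]: "A k \<in> sets P" for k unfolding A_def by measurable
  have disj: "disjoint_family_on A ?K"
    unfolding disjoint_family_on_def A_def using grid_bump_disjoint[OF m] by fast
  have F: "?f \<theta> \<in> F_INV" if "\<theta> \<subseteq> ?K" for \<theta>
    by (rule perturbed_id_in_F_INV[OF a m that])
  have meas: "?f \<theta> \<in> borel_measurable cube_borel" if "\<theta> \<subseteq> ?K" for \<theta>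
    by (rule F_INV_measurable[OF F[OF that]])
  \<comment> \<open>The factor 4 absorbs the constant of the two-point bound, so that the flip
    condition holds with constant 1; with the 2 of \<open>assouad\<close> it makes the 8.\<close>
  define R where "R \<theta> k = 4 * (\<integral>\<^sup>+D. local_loss P (A k) (fhat D) (?f \<theta>) \<partial>sample_law \<sigma> P n (?f \<theta>))" for \<theta> k
  have "(\<Sum>k\<in>?K. \<integral>\<^sup>+x. ennreal ((?u k x)\<^sup>2) \<partial>P) \<le> 2 * (4 * ?S)"
  proof (rule assouad[where R=R])
    fix \<theta> and k :: "nat \<times> nat" assume \<theta>: "\<theta> \<subseteq> ?K" and k: "k \<in> ?K"
    let ?\<theta>' = "sym_diff \<theta> {k}"
    have \<theta>': "?\<theta>' \<subseteq> ?K" using \<theta> k by auto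
    have fin: "finite \<theta>" using \<theta> by (rule finite_subset) auto
    have n: "norm (?f \<theta> x - ?f ?\<theta>' x) = ?u k x" for x
      by (rule norm_perturbed_id_flip[OF a(1) fin])
    have "?f \<theta> x $ 2 - ?f ?\<theta>' x $ 2 = 0" for x by (simp add: perturbed_id_def)
    then have n1: "(?f \<theta> x $ 1 - ?f ?\<theta>' x $ 1)\<^sup>2 = (?u k x)\<^sup>2" for x
      unfolding n[of x, symmetric] by (simp add: norm_vec_def L2_set_def UNIV_2)
    have "(\<integral>\<^sup>+x. ennreal ((?u k x)\<^sup>2) \<partial>P) = local_loss P (A k) (?f \<theta>) (?f ?\<theta>')"
      unfolding local_loss_def n1 by (intro nn_integral_cong) (auto simp: A_def indicator_def)
    also have "\<dots> \<le> R \<theta> k + R ?\<theta>' k"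
      unfolding R_def distrib_left[symmetric]
      by (rule local_loss_two_points[OF s fhat meas[OF \<theta>] meas[OF \<theta>'] A]) (simp add: n chi)
    finally show "(\<integral>\<^sup>+x. ennreal ((?u k x)\<^sup>2) \<partial>P) \<le> R \<theta> k + R ?\<theta>' k" .
  next
    fix \<theta> assume \<theta>: "\<theta> \<subseteq> ?K"
    have "(\<Sum>k\<in>?K. R \<theta> k) \<le> 4 * risk \<sigma> P n fhat (?f \<theta>)"
      unfolding R_def sum_distrib_left[symmetric]
      by (intro mult_left_mono sum_local_loss_le_risk[OF s fhat meas[OF \<theta>]] disj) auto
    also have "\<dots> \<le> 4 * ?S" by (intro mult_left_mono SUP_upper F \<theta>) auto
    finally show "(\<Sum>k\<in>?K. R \<theta> k) \<le> 4 * ?S" .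
  qed simp
  then show ?thesis by (simp flip: mult.assoc)
qed

text \<open>Taking \<open>m\<close> as \<open>n powr (1/4)\<close> rounded up balances the bump size \<open>1/m\<close> against the information
  \<open>n / m\<^sup>4\<close> that the sample carries about a single bump.\<close>
lemma minimax_lower_bound:
  assumes s: "\<sigma> > 0" and B: "B \<ge> 1"
  obtains C where "C > 0"
    "\<And>n fhat. n \<ge> 1 \<Longrightarrow> fhat \<in> estimators n \<Longrightarrow>
      ennreal (C * real n powr (- 1/2)) \<le> (SUP f\<in>F_INV. risk \<sigma> P n fhat f)"
proof -
  obtain \<kappa> where \<kappa>: "\<kappa> > 0"
    "\<And>A. A \<in> sets borel \<Longrightarrow> A \<subseteq> cube \<Longrightarrow> emeasure lborel A = ennreal (1/4) \<Longrightarrow> ennreal \<kappa> \<le> emeasure P A"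
    using emeasure_P_lower_bound by blast
  \<comment> \<open>The cap 1/4 keeps the perturbations in \<open>F_INV\<close>. The other cap makes
    \<open>8 * a^2 * B / \<sigma>^2\<close> at most 1/2, so the second moment for \<open>n\<close>
    observations is at most \<open>exp (1/2)\<close>, which is below 2.\<close>
  define a where "a = min (1/4) (\<sigma> / (4 * sqrt B))"
  have sB: "sqrt B \<ge> 1" using B by simp
  have a: "a > 0" "a \<le> 1/4" using s B by (auto simp: a_def)
  have a\<sigma>: "a \<le> \<sigma> / (4 * sqrt B)" by (simp add: a_def)
  have "a\<^sup>2 \<le> (\<sigma> / (4 * sqrt B))\<^sup>2" using a a\<sigma> by (intro power_mono) auto
  also have "\<dots> = \<sigma>\<^sup>2 / (16 * B)" using B by (simp add: power_divide power_mult_distrib)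
  finally have aB: "8 * a\<^sup>2 * B / \<sigma>\<^sup>2 \<le> 1/2" using B s by (simp add: field_simps)
  have "\<sigma> / (4 * sqrt B) \<le> \<sigma> / 1" 
  proof (rule divide_left_mono)
    show "1 \<le> 4 * sqrt B" using sB by linarith
  qed (use s B in auto)
  then have a_le: "a \<le> \<sigma>" using a\<sigma> by linarith
  \<comment> \<open>128 is 4 * 4 * 8: the squared half height of a bump, the loss from
    \<open>real m <= 2 * t\<close>, and the constant of \<open>sup_risk_lower_bound\<close>.\<close>
  define C where "C = a\<^sup>2 * \<kappa> / 128"
  have "ennreal (C * real n powr (- 1/2)) \<le> (SUP f\<in>F_INV. risk \<sigma> P n fhat f)"
    if n: "n \<ge> 1" and fhat: "fhat \<in> estimators n" for n fhat
  proof -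
    let ?S = "SUP f\<in>F_INV. risk \<sigma> P n fhat f"
    define t where "t = real n powr (1/4)"
    have t1: "t \<ge> 1" using n by (simp add: t_def ge_one_powr_ge_zero)
    have t4: "t ^ 4 = real n" using n by (simp add: t_def powr_powr flip: powr_numeral)
    have t2: "inverse (t\<^sup>2) = real n powr (- 1/2)"
      using n by (simp add: t_def powr_powr powr_minus flip: powr_numeral)
    define m where "m = nat \<lceil>t\<rceil>"
    have tm: "t \<le> real m" unfolding m_def by linarith
    \<comment> \<open>Rounding up adds less than 1, and \<open>t\<close> is at least 1.\<close>
    have mt: "real m \<le> 2 * t" unfolding m_def using t1 by linarith
    have m: "m > 0" using tm t1 by linarith
    have nm: "real n * (1 / real m) ^ 4 \<le> 1"
    proof -
      have "t ^ 4 \<le> real m ^ 4" using tm t1 by (intro power_mono) auto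
      then show ?thesis using m unfolding t4 by (simp add: power_divide divide_le_eq)
    qed
    have chi: "(\<integral>\<^sup>+x. ennreal (exp ((bump a (1 / real m) c x)\<^sup>2 / \<sigma>\<^sup>2)) \<partial>P) ^ n \<le> 2" for c
    proof -
      have "a * (1 / real m) \<le> a * 1" using a m by (intro mult_left_mono) auto
      then have "(\<integral>\<^sup>+x. ennreal (exp ((bump a (1 / real m) c x)\<^sup>2 / \<sigma>\<^sup>2)) \<partial>P)
          \<le> ennreal (1 + 8 * a\<^sup>2 * B / \<sigma>\<^sup>2 * (1 / real m)^4)"
        using a s B a_le by (intro nn_integral_exp_bump_le) auto
      also have "\<dots> \<le> ennreal (1 + 1/2 * (1 / real m)^4)"
        by (intro ennreal_leI add_left_mono mult_right_mono aB) auto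
      also have "\<dots> \<le> ennreal (exp (1/2 * (1 / real m)^4))"
        by (intro ennreal_leI exp_ge_add_one_self)
      finally have "(\<integral>\<^sup>+x. ennreal (exp ((bump a (1 / real m) c x)\<^sup>2 / \<sigma>\<^sup>2)) \<partial>P) ^ n
          \<le> ennreal (exp (1/2 * (1 / real m)^4)) ^ n"
        by (rule power_mono) simp
      also have "\<dots> = ennreal (exp (1/2 * (real n * (1 / real m)^4)))"
        by (simp add: ennreal_power exp_of_nat_mult[symmetric] mult.left_commute)
      also have "\<dots> \<le> ennreal 2"
      proof (rule ennreal_leI)
        have "exp (1/2 * (real n * (1 / real m)^4)) \<le> exp (1/2 :: real)" using nm by simp
        also have "\<dots> \<le> 2" using exp_bound[of "1/2"] by (simp add: power2_eq_square)
        finally show "exp (1/2 * (real n * (1 / real m)^4)) \<le> 2" .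
      qed
      finally show ?thesis by simp
    qed
    have "C * inverse (t\<^sup>2) \<le> (a / (2 * real m))\<^sup>2 * \<kappa> / 8"
    proof -
      have "(real m)\<^sup>2 \<le> (2 * t)\<^sup>2" using mt m by (intro power_mono) auto
      then have "inverse (t\<^sup>2) \<le> 4 * inverse ((real m)\<^sup>2)"
        using m t1 by (simp add: field_simps)
      then have "C * inverse (t\<^sup>2) \<le> C * (4 * inverse ((real m)\<^sup>2))"
        using \<kappa>(1) by (intro mult_left_mono) (auto simp: C_def)
      also have "\<dots> = (a / (2 * real m))\<^sup>2 * \<kappa> / 8"
        using m by (simp add: C_def field_simps)
      finally show ?thesis .
    qed
    then have "8 * (C * inverse (t\<^sup>2)) \<le> (a / (2 * real m))\<^sup>2 * \<kappa>" by linarith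
    then have "ennreal (8 * (C * inverse (t\<^sup>2))) \<le> ennreal ((a / (2 * real m))\<^sup>2 * \<kappa>)"
      by (rule ennreal_leI)
    also have "\<dots> \<le> (\<Sum>k\<in>{..<m} \<times> {..<m}. \<integral>\<^sup>+x. ennreal ((bump a (1 / real m) (grid_center m k) x)\<^sup>2) \<partial>P)"
      by (rule sum_nn_integral_bump_sq_ge[OF _ m \<kappa>(2)]) (use a(1) \<kappa>(1) in simp_all)
    also have "\<dots> \<le> 8 * ?S"
      by (rule sup_risk_lower_bound[OF s fhat _ a(2) m chi]) (use a in simp)
    finally have "ennreal (8 * (C * inverse (t\<^sup>2))) \<le> 8 * ?S" .
    moreover have "ennreal (8 * (C * inverse (t\<^sup>2))) = 8 * ennreal (C * inverse (t\<^sup>2))"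
      by (subst ennreal_mult') simp_all
    ultimately have "8 * ennreal (C * inverse (t\<^sup>2)) \<le> 8 * ?S" by (simp only:)
    then have "ennreal (C * inverse (t\<^sup>2)) \<le> ?S"
      using ennreal_mult_le_mult_iff[of 8] by simp
    then show ?thesis by (simp add: t2)
  qed
  moreover have "C > 0" using a \<kappa> by (simp add: C_def)
  ultimately show thesis using that by blast
qed

end

theorem theorem4:
  fixes \<sigma> :: real and P :: "(real^2) measure" and p :: "real^2 \<Rightarrow> real"
  assumes "\<sigma> > 0"
    and "prob_space P"
    and "p \<in> borel_measurable cube_borel"
    and "P = density (restrict_space lborel cube) (\<lambda>x. ennreal (p x))"
    and "\<forall>x\<in>cube. p x > 0"
    and "\<exists>B. \<forall>x\<in>cube. p x \<le> B"
  shows "\<exists>C>0. \<forall>n\<ge>1.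
    (INF fhat\<in>estimators n. SUP f\<in>F_INV. risk \<sigma> P n fhat f)
      \<ge> ennreal (C * real n powr (- 2 / (2 + real CARD(2))))"
proof -
  obtain B where B: "\<forall>x\<in>cube. p x \<le> B" using assms(6) by blast
  interpret prob_space P by (rule assms(2))
  \<comment> \<open>Raising the bound to at least 1 supplies the condition on \<open>B\<close> in
    \<open>minimax_lower_bound\<close>.\<close>
  interpret cube_density P p "max 1 B"
  proof
    show "p x \<le> max 1 B" if "x \<in> cube" for x
      using B that by (meson max.coboundedI2)
    show "0 < p x" if "x \<in> cube" for x
      using assms(5) that by blast
  qed (fact assms(3), fact assms(4))
  obtain C where C: "C > 0" "\<And>n fhat. n \<ge> 1 \<Longrightarrow> fhat \<in> estimators n \<Longrightarrow>
      ennreal (C * real n powr (- 1/2)) \<le> (SUP f\<in>F_INV. risk \<sigma> P n fhat f)"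
    using minimax_lower_bound[OF assms(1)] max.cobounded1 by blast
  show ?thesis
  proof (intro exI[of _ C] conjI allI impI INF_greatest C(1))
    fix n :: nat and fhat assume n: "n \<ge> 1" and fhat: "fhat \<in> estimators n"
    have "- 2 / (2 + real CARD(2)) = - 1/2" by simp
    then show "ennreal (C * real n powr (- 2 / (2 + real CARD(2)))) \<le> (SUP f\<in>F_INV. risk \<sigma> P n fhat f)"
      using C(2)[OF n fhat] by simp
  qed
qed

end
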